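(* Let $q=2^d$ for some positive integer $d$, let $E=(\mathrm{GF}(q)^2,+)$, let $K'=\langle y,u : y^{(q+2)/2}=u^2=1,\ u^{-1}yu=y^{-1}\rangle$ be the dihedral group of order $q+2$, and let $G'=E\times K'$. Let $\psi$ be the order $2$ automorphism of $G'$ given by $((a,b),x)^\psi:=((b,a),u^{-1}xu)$. Let $e_1,\dots,e_{2d}$ be generators for $E$, where $e_1=(1,0)$ and $e_2=(0,1)$. Define the subgroup of $\langle\psi\rangle\ltimes G'$ $$\mathcal{G}':=\langle(\psi,e_1,1),\ (1,0,y),\ (1,0,u),\ (1,e_1+e_2,1),\ (1,e_i,1) : 3\le i\le 2d\rangle.$$ Then $\mathcal{G}'$ is a nonabelian group containing a difference set with McFarland parameters $$\left(q^2(q+2),\ q(q+1),\ q\right)$$ that does not have a normal Sylow $2$-subgroup and that does not contain a normal elementary abelian subgroup of order $q^2$.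
   Context: A subset $D$ of a finite group $G$ is a $(v,k,\lambda)$-difference set if $|G|=v$, $|D|=k$, and every nonidentity $g\in G$ can be expressed in exactly $\lambda$ ways as $d_1d_2^{-1}$ with $d_1,d_2\in D$. McFarland parameters, for a prime power $q$ and positive integer $s$, are $v=q^{s+1}\left(\frac{q^{s+1}-1}{q-1}+1\right)$, $k=q^s\,\frac{q^{s+1}-1}{q-1}$, $\lambda=q^s\,\frac{q^s-1}{q-1}$; here $s=1$. The final two properties (no normal Sylow $2$-subgroup, no normal elementary abelian subgroup of order $q^2$) are asserted of the group $\mathcal{G}'$. Elements of $\langle\psi\rangle\ltimes G'$ are written as triples $(\alpha,b,c)$ with $\alpha\in\langle\psi\rangle$, $b\in E$ (additive, identity $0$), $c\in K'$ (multiplicative, identity $1$), where $(\alpha,b,c)$ stands for the pair $(\alpha,(b,c))$. Automorphisms act on the right and multiplication of pairs is $(\alpha,g)(\beta,h)=(\alpha\beta,\ g^\beta h)$ for $\alpha,\beta\in\langle\psi\rangle$ and $g,h\in G'$.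
   Formalization: For d=1 the group is C4×C2×C2, so nonabelian and the two "no normal subgroup" claims are asserted only for d≥2; the e_i are assumed to make ⟨e1+e2,e3,…,e2d⟩ invariant under swapping coordinates, since otherwise the group is all of ⟨ψ⟩⋉G', of order 2q²(q+2), with E normal. *)

theory Defs
  imports "HOL-Algebra.Algebra"
begin

section \<open>Difference sets\<close>

definition difference_set ::
  "('a, 'b) monoid_scheme \<Rightarrow> nat \<Rightarrow> nat \<Rightarrow> nat \<Rightarrow> 'a set \<Rightarrow> bool" where
  "difference_set G v k l D \<longleftrightarrow>
     group G \<and> finite (carrier G) \<and> order G = v \<and> D \<subseteq> carrier G \<and> card D = k \<and>
     (\<forall>g \<in> carrier G - {\<one>\<^bsub>G\<^esub>}.
        card {(d1, d2). d1 \<in> D \<and> d2 \<in> D \<and> g = d1 \<otimes>\<^bsub>G\<^esub> inv\<^bsub>G\<^esub> d2} = l)"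

text \<open>All divisions below are exact when \<open>q > 1\<close>.\<close>

definition mcfarland_parameters :: "nat \<Rightarrow> nat \<Rightarrow> nat \<times> nat \<times> nat" where
  "mcfarland_parameters q s =
     (q ^ (s + 1) * ((q ^ (s + 1) - 1) div (q - 1) + 1),
      q ^ s * ((q ^ (s + 1) - 1) div (q - 1)),
      q ^ s * ((q ^ s - 1) div (q - 1)))"


section \<open>Group-theoretic notions\<close>

text \<open>The group with presentation \<open>\<langle>y, u : y\<^sup>n = u\<^sup>2 = 1, u\<^sup>-\<^sup>1 y u = y\<^sup>-\<^sup>1\<rangle>\<close>, described up to isomorphism:
  every group generated by elements satisfying these relations is a quotient of the presented group,
  which has order \<open>2 n\<close>, so the condition on the order says that there are no further relations.
  For \<open>n = 2\<close> this is the Klein four-group.\<close>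

definition dihedral_presentation ::
  "('k, 'c) monoid_scheme \<Rightarrow> nat \<Rightarrow> 'k \<Rightarrow> 'k \<Rightarrow> bool" where
  "dihedral_presentation K n y u \<longleftrightarrow>
     group K \<and> order K = 2 * n \<and>
     y \<in> carrier K \<and> u \<in> carrier K \<and> generate K {y, u} = carrier K \<and>
     y [^]\<^bsub>K\<^esub> n = \<one>\<^bsub>K\<^esub> \<and> u [^]\<^bsub>K\<^esub> (2::nat) = \<one>\<^bsub>K\<^esub> \<and>
     inv\<^bsub>K\<^esub> u \<otimes>\<^bsub>K\<^esub> y \<otimes>\<^bsub>K\<^esub> u = inv\<^bsub>K\<^esub> y"

definition sylow_subgroup :: "nat \<Rightarrow> 'a set \<Rightarrow> ('a, 'b) monoid_scheme \<Rightarrow> bool" where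
  "sylow_subgroup p P G \<longleftrightarrow> subgroup P G \<and> card P = p ^ multiplicity p (order G)"

definition elementary_abelian :: "('a, 'b) monoid_scheme \<Rightarrow> bool" where
  "elementary_abelian G \<longleftrightarrow>
     comm_group G \<and> (\<exists>p::nat. Factorial_Ring.prime p \<and> (\<forall>x \<in> carrier G. x [^]\<^bsub>G\<^esub> p = \<one>\<^bsub>G\<^esub>))"

text \<open>The semidirect product \<open>A \<ltimes> G\<close> of \<open>G\<close> with a subgroup \<open>A\<close> of its automorphism group, with
  automorphisms acting on the right: \<open>(\<alpha>, g) (\<beta>, h) = (\<alpha> \<beta>, g\<^sup>\<beta> h)\<close>. Since \<open>\<alpha> \<beta>\<close> is then
  ``first \<open>\<alpha>\<close>, then \<open>\<beta>\<close>'', whereas multiplication in \<^const>\<open>AutoGroup\<close> is composition of functions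
  acting on the left, the factors are exchanged in the first component.\<close>

definition semidirect ::
  "('a \<Rightarrow> 'a) set \<Rightarrow> ('a, 'b) monoid_scheme \<Rightarrow> (('a \<Rightarrow> 'a) \<times> 'a) monoid" where
  "semidirect A G =
     \<lparr>carrier = A \<times> carrier G,
      monoid.mult = (\<lambda>(\<alpha>, g) (\<beta>, h). (\<beta> \<otimes>\<^bsub>AutoGroup G\<^esub> \<alpha>, \<beta> g \<otimes>\<^bsub>G\<^esub> h)),
      one = (\<one>\<^bsub>AutoGroup G\<^esub>, \<one>\<^bsub>G\<^esub>)\<rparr>"


section \<open>The construction\<close>

definition group_E :: "('f, 'm) ring_scheme \<Rightarrow> ('f \<times> 'f) monoid" where
  "group_E F = add_monoid F \<times>\<times> add_monoid F"

definition group_G' ::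
  "('f, 'm) ring_scheme \<Rightarrow> ('k, 'c) monoid_scheme \<Rightarrow> (('f \<times> 'f) \<times> 'k) monoid" where
  "group_G' F K = group_E F \<times>\<times> K"

definition aut_psi ::
  "('f, 'm) ring_scheme \<Rightarrow> ('k, 'c) monoid_scheme \<Rightarrow> 'k
    \<Rightarrow> ('f \<times> 'f) \<times> 'k \<Rightarrow> ('f \<times> 'f) \<times> 'k" where
  "aut_psi F K u =
     (\<lambda>((a, b), x) \<in> carrier (group_G' F K). ((b, a), inv\<^bsub>K\<^esub> u \<otimes>\<^bsub>K\<^esub> x \<otimes>\<^bsub>K\<^esub> u))"

definition psi_ext ::
  "('f, 'm) ring_scheme \<Rightarrow> ('k, 'c) monoid_scheme \<Rightarrow> 'k
    \<Rightarrow> ((('f \<times> 'f) \<times> 'k \<Rightarrow> ('f \<times> 'f) \<times> 'k) \<times> (('f \<times> 'f) \<times> 'k)) monoid" where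
  "psi_ext F K u =
     semidirect (generate (AutoGroup (group_G' F K)) {aut_psi F K u}) (group_G' F K)"

definition group_calG' ::
  "nat \<Rightarrow> ('f, 'm) ring_scheme \<Rightarrow> ('k, 'c) monoid_scheme \<Rightarrow> 'k \<Rightarrow> 'k \<Rightarrow> (nat \<Rightarrow> 'f \<times> 'f)
    \<Rightarrow> ((('f \<times> 'f) \<times> 'k \<Rightarrow> ('f \<times> 'f) \<times> 'k) \<times> (('f \<times> 'f) \<times> 'k)) monoid" where
  "group_calG' d F K y u e =
     (let \<iota> = \<one>\<^bsub>AutoGroup (group_G' F K)\<^esub>; o\<^sub>E = \<one>\<^bsub>group_E F\<^esub> in
      (psi_ext F K u)
        \<lparr>carrier := generate (psi_ext F K u)
           ({(aut_psi F K u, (e 1, \<one>\<^bsub>K\<^esub>)),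
             (\<iota>, (o\<^sub>E, y)),
             (\<iota>, (o\<^sub>E, u)),
             (\<iota>, (e 1 \<otimes>\<^bsub>group_E F\<^esub> e 2, \<one>\<^bsub>K\<^esub>))} \<union>
            {(\<iota>, (e i, \<one>\<^bsub>K\<^esub>)) | i. 3 \<le> i \<and> i \<le> 2 * d})\<rparr>)"

text \<open>For \<open>d = 1\<close> this group is \<open>C\<^sub>4 \<times> C\<^sub>2 \<times> C\<^sub>2\<close>: \<open>K\<close> is then the Klein four-group, on which
  \<open>\<psi>\<close> acts trivially. It still contains a McFarland difference set, but it is an abelian 2-group.\<close>

text \<open>The generators \<open>e\<^sub>1, \<dots>, e\<^sub>2\<^sub>d\<close> of \<open>E\<close>. The last condition says that the coordinate swap preserves
  the index 2 subgroup \<open>\<langle>e\<^sub>1 + e\<^sub>2, e\<^sub>3, \<dots>, e\<^sub>2\<^sub>d\<rangle>\<close> of \<open>E\<close>. It holds for the natural continuation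
  \<open>(1,0), (0,1), (a\<^sub>2,0), (0,a\<^sub>2), \<dots>, (a\<^sub>d,0), (0,a\<^sub>d)\<close> of \<open>e\<^sub>1, e\<^sub>2\<close>, where \<open>1, a\<^sub>2, \<dots>, a\<^sub>d\<close> is
  a basis of \<open>F\<close> over its prime field, and it cannot be dropped: if it fails, the group generated
  above is all of \<open>\<langle>\<psi>\<rangle> \<ltimes> G'\<close>, of order \<open>2 q\<^sup>2 (q + 2)\<close>, as for \<open>d = 2\<close>, \<open>e\<^sub>3 = (w,0)\<close>,
  \<open>e\<^sub>4 = (1,w)\<close> with \<open>w \<notin> {0, 1}\<close>.\<close>

definition admissible_generators ::
  "nat \<Rightarrow> ('f, 'm) ring_scheme \<Rightarrow> (nat \<Rightarrow> 'f \<times> 'f) \<Rightarrow> bool" where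
  "admissible_generators d F e \<longleftrightarrow>
     (\<forall>i \<in> {1..2 * d}. e i \<in> carrier (group_E F)) \<and>
     generate (group_E F) (e ` {1..2 * d}) = carrier (group_E F) \<and>
     e 1 = (\<one>\<^bsub>F\<^esub>, \<zero>\<^bsub>F\<^esub>) \<and> e 2 = (\<zero>\<^bsub>F\<^esub>, \<one>\<^bsub>F\<^esub>) \<and>
     (let H = generate (group_E F) ({e 1 \<otimes>\<^bsub>group_E F\<^esub> e 2} \<union> e ` {3..2 * d})
      in prod.swap ` H = H)"

end

theory Submission
  imports Defs
begin

text \<open>
  Why the theorem holds. Inside \<open>\<langle>\<psi>\<rangle> \<ltimes> G'\<close>, a normal subgroup \<open>G\<^sub>0\<close> of index 2 in \<open>G'\<close> that is
  preserved by \<open>\<psi>\<close> gives rise to a copy of the \<^emph>\<open>set\<close> \<open>G'\<close> with a twisted multiplication: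
  the elements \<open>(1, g)\<close> with \<open>g \<in> G\<^sub>0\<close> and \<open>(\<psi>, g)\<close> with \<open>g \<notin> G\<^sub>0\<close> form a subgroup. Quotients
  \<open>g h\<^sup>-\<^sup>1\<close> change under the twist only by an application of \<open>\<psi>\<close> that depends on \<open>h\<close>, so a
  difference set of \<open>G'\<close> that is invariant under \<open>\<psi>\<close> remains a difference set of the twisted group
  (\<open>difference_set_twist\<close>). With \<open>H = \<langle>e\<^sub>1 + e\<^sub>2, e\<^sub>3, \<dots>\<rangle>\<close>, which has index 2 in \<open>E\<close> because \<open>E\<close> has
  rank \<open>2 d\<close> over the field with two elements, the group of the theorem is the twist of \<open>E \<times> K'\<close>
  along \<open>H \<times> K'\<close> (\<open>calG'_eq_twisted\<close>).

  An invariant difference set comes from McFarland's construction: the \<open>q + 1\<close> lines through the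
  origin of \<open>GF(q)\<^sup>2\<close>, placed in \<open>q + 1\<close> different cosets of \<open>E\<close>, always form a difference set
  (\<open>difference_set_of_spread\<close>), so only the assignment of lines to elements of \<open>K'\<close> has to be made
  compatible with \<open>\<psi>\<close>. The coordinate swap acts on the lines as an involution whose only fixed line is
  the diagonal. For \<open>d \<ge> 2\<close> the number \<open>(q + 2) / 2\<close> is odd, conjugation by \<open>u\<close> fixes only \<open>1\<close> and
  \<open>u\<close>, and on \<open>K' - {u}\<close> it is an involution with one fixed point as well. Two involutions of finite
  sets of the same size with the same number of fixed points are isomorphic
  (\<open>equivariant_bij_of_involutions\<close>), which gives the assignment. For \<open>d = 1\<close> conjugation by \<open>u\<close> is
  trivial on the Klein four-group and no such assignment exists; there the six elements of \<open>E \<times> K'\<close>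
  with exactly one trivial component do the job (\<open>difference_set_of_crossing_factors\<close>).

  For the negative statements, \<open>(\<psi>\<^sup>i, b, c) \<mapsto> u\<^sup>i c\<close> is a homomorphism onto \<open>K'\<close>. For \<open>d \<ge> 2\<close> the
  dihedral group \<open>K'\<close> has no nontrivial normal 2-subgroup, hence every normal 2-subgroup lies in the
  kernel (\<open>normal_2_subgroup_in_kernel\<close>), which has order \<open>q\<^sup>2\<close>. That is half the order of a Sylow
  2-subgroup; and the kernel itself, the only candidate for a normal subgroup of order \<open>q\<^sup>2\<close>, contains
  \<open>(\<psi>, e\<^sub>1, u)\<close>, whose square is \<open>e\<^sub>1 + e\<^sub>2 \<noteq> 0\<close>.
\<close>

section \<open>Exponents and generators in groups\<close>

lemma (in group) eq_one_if_coprime_exponents: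
  fixes m n :: nat
  assumes "x \<in> carrier G" "x [^] m = \<one>" "x [^] n = \<one>" "coprime m n"
  shows "x = \<one>"
proof -
  have "ord x dvd m" "ord x dvd n"
    using assms pow_eq_id by auto
  then have "ord x = 1"
    using assms(4) coprime_common_divisor_nat by blast
  then show ?thesis
    using assms(1) ord_eq_1 by blast
qed

lemma (in group) mult_eq_one_iff:
  assumes "x \<in> carrier G" "y \<in> carrier G"
  shows "x \<otimes> y = \<one> \<longleftrightarrow> y = inv x"
proof
  assume "x \<otimes> y = \<one>"
  then have "inv y = x"
    using assms by (intro inv_equality)
  then have "inv (inv y) = inv x"
    by simp
  then show "y = inv x"
    using assms by simp
qed (use assms in simp)

lemma (in group) pow_two: "x \<in> carrier G \<Longrightarrow> x [^] (2::nat) = x \<otimes> x"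
  by (simp add: numeral_2_eq_2)

lemma (in group) pow_card_subgroup:
  assumes "subgroup N G" "x \<in> N"
  shows "x [^] card N = \<one>"
proof -
  interpret N: group "G\<lparr>carrier := N\<rparr>"
    using assms(1) by (rule subgroup_imp_group)
  have "x [^]\<^bsub>G\<lparr>carrier := N\<rparr>\<^esub> order (G\<lparr>carrier := N\<rparr>) = \<one>\<^bsub>G\<lparr>carrier := N\<rparr>\<^esub>"
    using assms(2) by (intro N.pow_order_eq_1) simp
  then show ?thesis
    by (simp add: order_def flip: nat_pow_consistent)
qed

text \<open>In exponent 2 adjoining a generator at most doubles a subgroup: the subgroup and its translate
  by the new generator together are already closed.\<close>

lemma (in comm_group) generate_insert_subset:
  assumes exponent: "\<And>g. g \<in> carrier G \<Longrightarrow> g \<otimes> g = \<one>"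
    and A: "A \<subseteq> carrier G" and x: "x \<in> carrier G"
  shows "generate G (insert x A) \<subseteq> generate G A \<union> (\<lambda>h. x \<otimes> h) ` generate G A"
proof -
  interpret H: subgroup "generate G A" G
    using A by (rule generate_is_subgroup)
  have inv_self: "inv g = g" if "g \<in> carrier G" for g
    using that exponent by (intro inv_equality)
  have Hc: "h \<in> carrier G" if "h \<in> generate G A" for h
    using that by (rule H.mem_carrier)
  have "subgroup (generate G A \<union> (\<lambda>h. x \<otimes> h) ` generate G A) G"
  proof (rule subgroupI)
    show sub: "generate G A \<union> (\<lambda>h. x \<otimes> h) ` generate G A \<subseteq> carrier G"
      using Hc x by auto
    show "generate G A \<union> (\<lambda>h. x \<otimes> h) ` generate G A \<noteq> {}"
      using H.one_closed by blast
    show "inv g \<in> generate G A \<union> (\<lambda>h. x \<otimes> h) ` generate G A"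
      if "g \<in> generate G A \<union> (\<lambda>h. x \<otimes> h) ` generate G A" for g
      using inv_self[OF subsetD[OF sub that]] that by simp
  next
    fix a b
    assume ab: "a \<in> generate G A \<union> (\<lambda>h. x \<otimes> h) ` generate G A"
      "b \<in> generate G A \<union> (\<lambda>h. x \<otimes> h) ` generate G A"
    then obtain h k where hk: "h \<in> generate G A" "k \<in> generate G A"
      "a = h \<or> a = x \<otimes> h" "b = k \<or> b = x \<otimes> k"
      by blast
    have "h \<otimes> (x \<otimes> k) = x \<otimes> (h \<otimes> k)"
      using hk Hc x by (simp add: m_lcomm)
    moreover have "x \<otimes> h \<otimes> k = x \<otimes> (h \<otimes> k)"
      using hk Hc x by (simp add: m_assoc)
    moreover have "x \<otimes> h \<otimes> (x \<otimes> k) = h \<otimes> k"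
    proof -
      have "x \<otimes> h \<otimes> (x \<otimes> k) = x \<otimes> x \<otimes> (h \<otimes> k)"
        using hk Hc x by (simp add: m_ac)
      then show ?thesis
        using exponent[OF x] hk Hc by simp
    qed
    moreover have "h \<otimes> k \<in> generate G A"
      using hk by simp
    ultimately show "a \<otimes> b \<in> generate G A \<union> (\<lambda>h. x \<otimes> h) ` generate G A"
      using hk(3,4) by (elim disjE) simp_all
  qed
  moreover have "insert x A \<subseteq> generate G A \<union> (\<lambda>h. x \<otimes> h) ` generate G A"
  proof -
    have "x \<otimes> \<one> \<in> (\<lambda>h. x \<otimes> h) ` generate G A"
      using H.one_closed by (rule imageI)
    then have "x \<in> (\<lambda>h. x \<otimes> h) ` generate G A"
      using x by simp
    then show ?thesis
      using generate.incl[of _ A G] by blast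
  qed
  ultimately show ?thesis
    by (intro generate_subgroup_incl)
qed

text \<open>Fewer generators than the rank cannot generate everything: this bound is what shows that the
  subgroup \<open>H\<close> below is proper.\<close>

lemma (in comm_group) card_generate_le:
  assumes exponent: "\<And>g. g \<in> carrier G \<Longrightarrow> g \<otimes> g = \<one>"
    and "finite A" "A \<subseteq> carrier G"
  shows "finite (generate G A) \<and> card (generate G A) \<le> 2 ^ card A"
  using assms(2,3)
proof (induction A)
  case empty
  then show ?case
    by (simp add: generate_empty)
next
  case (insert x A)
  let ?H = "generate G A"
  have IH: "finite ?H" "card ?H \<le> 2 ^ card A"
    using insert by auto
  have sub: "generate G (insert x A) \<subseteq> ?H \<union> (\<lambda>h. x \<otimes> h) ` ?H"
    using insert.prems by (intro generate_insert_subset exponent) auto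
  have fin: "finite (?H \<union> (\<lambda>h. x \<otimes> h) ` ?H)"
    using IH by simp
  have "card (generate G (insert x A)) \<le> card (?H \<union> (\<lambda>h. x \<otimes> h) ` ?H)"
    using fin sub by (rule card_mono)
  also have "\<dots> \<le> card ?H + card ((\<lambda>h. x \<otimes> h) ` ?H)"
    by (rule card_Un_le)
  also have "\<dots> \<le> 2 * card ?H"
    using card_image_le[OF IH(1)] by simp
  finally show ?case
    using IH insert.hyps finite_subset[OF sub fin] by simp
qed

text \<open>Each factor embeds homomorphically, and every pair is the product of its two embedded components.\<close>

lemma generate_DirProd:
  assumes G: "group G" and K: "group K" and A: "A \<subseteq> carrier G" and C: "C \<subseteq> carrier K"
  shows "generate (G \<times>\<times> K) ((\<lambda>x. (x, \<one>\<^bsub>K\<^esub>)) ` A \<union> (\<lambda>k. (\<one>\<^bsub>G\<^esub>, k)) ` C) = generate G A \<times> generate K C"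
    (is "generate _ ?S = _")
proof
  interpret G: group G by fact
  interpret K: group K by fact
  interpret GK: group "G \<times>\<times> K" by (intro DirProd_group G K)
  have S: "?S \<subseteq> carrier (G \<times>\<times> K)"
    using A C by auto
  show "generate (G \<times>\<times> K) ?S \<subseteq> generate G A \<times> generate K C"
  proof (rule GK.generate_subgroup_incl)
    show "?S \<subseteq> generate G A \<times> generate K C"
      by (auto intro: generate.one generate.incl)
    show "subgroup (generate G A \<times> generate K C) (G \<times>\<times> K)"
      by (intro DirProd_subgroups G K G.generate_is_subgroup K.generate_is_subgroup A C)
  qed
  have left: "generate (G \<times>\<times> K) ((\<lambda>x. (x, \<one>\<^bsub>K\<^esub>)) ` A) = (\<lambda>x. (x, \<one>\<^bsub>K\<^esub>)) ` generate G A"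
    using A by (intro group_hom.generate_img)
      (auto simp: group_hom_def group_hom_axioms_def hom_def G.is_group GK.is_group)
  have right: "generate (G \<times>\<times> K) ((\<lambda>k. (\<one>\<^bsub>G\<^esub>, k)) ` C) = (\<lambda>k. (\<one>\<^bsub>G\<^esub>, k)) ` generate K C"
    using C by (intro group_hom.generate_img)
      (auto simp: group_hom_def group_hom_axioms_def hom_def K.is_group GK.is_group)
  show "generate G A \<times> generate K C \<subseteq> generate (G \<times>\<times> K) ?S"
  proof clarify
    fix a c
    assume ac: "a \<in> generate G A" "c \<in> generate K C"
    have "(a, \<one>\<^bsub>K\<^esub>) \<in> generate (G \<times>\<times> K) ?S"
      using ac(1) left GK.mono_generate[of "(\<lambda>x. (x, \<one>\<^bsub>K\<^esub>)) ` A" ?S] by blast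
    moreover have "(\<one>\<^bsub>G\<^esub>, c) \<in> generate (G \<times>\<times> K) ?S"
      using ac(2) right GK.mono_generate[of "(\<lambda>k. (\<one>\<^bsub>G\<^esub>, k)) ` C" ?S] by blast
    ultimately have "(a, \<one>\<^bsub>K\<^esub>) \<otimes>\<^bsub>G \<times>\<times> K\<^esub> (\<one>\<^bsub>G\<^esub>, c) \<in> generate (G \<times>\<times> K) ?S"
      by (rule generate.eng)
    moreover have "a \<in> carrier G" "c \<in> carrier K"
      using ac A C G.generate_in_carrier K.generate_in_carrier by auto
    ultimately show "(a, c) \<in> generate (G \<times>\<times> K) ?S"
      by simp
  qed
qed

text \<open>The map \<open>(x, z) \<mapsto> x z\<^sup>-\<^sup>1\<close> from \<open>Q \<times> P\<close> is injective since the subgroups meet trivially, and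
  therefore bijective by counting: each \<open>b\<close> has exactly one factorization \<open>b = x z\<^sup>-\<^sup>1\<close>.\<close>

lemma (in group) ex1_translate_of_complements:
  assumes fin: "finite (carrier G)" and P: "subgroup P G" and Q: "subgroup Q G"
    and triv: "P \<inter> Q = {\<one>}" and card: "card P * card Q = order G"
    and b: "b \<in> carrier G"
  shows "\<exists>!z. z \<in> P \<and> b \<otimes> z \<in> Q"
proof -
  note Pc = subgroup.mem_carrier[OF P] and Qc = subgroup.mem_carrier[OF Q]
  have inj: "inj_on (\<lambda>(x, z). x \<otimes> inv z) (Q \<times> P)"
  proof (rule inj_onI, clarify)
    fix x z x' z'
    assume m: "x \<in> Q" "z \<in> P" "x' \<in> Q" "z' \<in> P" and eq: "x \<otimes> inv z = x' \<otimes> inv z'"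
    have c: "x \<in> carrier G" "z \<in> carrier G" "x' \<in> carrier G" "z' \<in> carrier G"
      using m Pc Qc by auto
    have "x = x' \<otimes> (inv z' \<otimes> z)"
      using eq c inv_solve_right[of "x' \<otimes> inv z'" x z] by (simp add: m_assoc)
    then have "inv x' \<otimes> x = inv z' \<otimes> z"
      using c by (simp add: m_assoc[symmetric])
    moreover have "inv x' \<otimes> x \<in> Q" "inv z' \<otimes> z \<in> P"
      using m P Q by (auto intro: subgroup.m_closed subgroup.m_inv_closed)
    ultimately have "inv x' \<otimes> x = \<one>" "inv z' \<otimes> z = \<one>"
      using triv by auto
    then show "x = x' \<and> z = z'"
      using c inv_solve_left'[of \<one> x' x] inv_solve_left'[of \<one> z' z] by simp
  qed
  have "(\<lambda>(x, z). x \<otimes> inv z) ` (Q \<times> P) = carrier G"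
  proof (rule card_subset_eq[OF fin])
    show "(\<lambda>(x, z). x \<otimes> inv z) ` (Q \<times> P) \<subseteq> carrier G"
      using Pc Qc by auto
    show "card ((\<lambda>(x, z). x \<otimes> inv z) ` (Q \<times> P)) = card (carrier G)"
      using card by (simp add: card_image[OF inj] card_cartesian_product order_def mult.commute)
  qed
  then obtain x z where xz: "x \<in> Q" "z \<in> P" "b = x \<otimes> inv z"
    using b by force
  then have "b \<otimes> z = x"
    using Pc Qc by (simp add: m_assoc)
  moreover have "z' = z" if z': "z' \<in> P" "b \<otimes> z' \<in> Q" for z'
  proof -
    have eq: "b = (b \<otimes> z') \<otimes> inv z'"
      using z' b Pc by (simp add: m_assoc)
    have "(\<lambda>(x, z). x \<otimes> inv z) (b \<otimes> z', z') = (\<lambda>(x, z). x \<otimes> inv z) (x, z)"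
      using eq xz by simp
    then show ?thesis
      using inj_onD[OF inj, of "(b \<otimes> z', z')" "(x, z)"] z' xz by auto
  qed
  ultimately show ?thesis
    using xz by blast
qed

section \<open>Difference sets in direct products\<close>

text \<open>In this form, the number of elements of \<open>D\<close> that translation by \<open>g\<close> keeps in \<open>D\<close>, the counts in
  product groups and in twisted groups involve no inverses.\<close>

lemma (in group) card_difference_pairs:
  assumes D: "D \<subseteq> carrier G" and g: "g \<in> carrier G"
  shows "card {(d1, d2). d1 \<in> D \<and> d2 \<in> D \<and> g = d1 \<otimes> inv d2} = card {h \<in> D. g \<otimes> h \<in> D}"
proof -
  have iff: "g = d1 \<otimes> inv d2 \<longleftrightarrow> d1 = g \<otimes> d2" if "d1 \<in> D" "d2 \<in> D" for d1 d2
    using that g D by (metis inv_solve_right subsetD)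
  have "{(d1, d2). d1 \<in> D \<and> d2 \<in> D \<and> g = d1 \<otimes> inv d2}
      = {(d1, d2). d1 \<in> D \<and> d2 \<in> D \<and> d1 = g \<otimes> d2}"
    using iff by blast
  also have "\<dots> = (\<lambda>h. (g \<otimes> h, h)) ` {h \<in> D. g \<otimes> h \<in> D}"
    by auto
  finally show ?thesis
    by (simp add: card_image inj_on_def)
qed

lemma (in group) difference_set_iff_translates:
  assumes "finite (carrier G)" "D \<subseteq> carrier G"
  shows "difference_set G v k l D \<longleftrightarrow> order G = v \<and> card D = k \<and>
           (\<forall>g \<in> carrier G - {\<one>}. card {h \<in> D. g \<otimes> h \<in> D} = l)"
  using assms by (auto simp: difference_set_def card_difference_pairs)

lemma (in group) difference_setI:
  assumes "finite (carrier G)" "order G = v" "D \<subseteq> carrier G" "card D = k"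
    and "\<And>g. \<lbrakk>g \<in> carrier G; g \<noteq> \<one>\<rbrakk> \<Longrightarrow> card {h \<in> D. g \<otimes> h \<in> D} = l"
  shows "difference_set G v k l D"
  using assms by (simp add: difference_set_iff_translates)

text \<open>McFarland's construction. The subgroups \<open>L k\<close> form a spread of \<open>E\<close>, and each occupies the coset
  of its own \<open>k\<close>; one element \<open>k0\<close> of \<open>K\<close> is left without a subgroup. A translation by \<open>(b, 1)\<close>
  preserves exactly the one subgroup that contains \<open>b\<close> and moves the others off themselves, which
  contributes \<open>q\<close>. A translation by \<open>(b, c)\<close> with \<open>c \<noteq> 1\<close> compares different subgroups, which are
  complements of each other and meet in one point after any translation; the pairs \<open>k, c k\<close> that
  avoid \<open>k0\<close> are \<open>q\<close> in number.\<close>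

lemma difference_set_of_spread:
  fixes E :: "('a, 'b) monoid_scheme" and K :: "('k, 'c) monoid_scheme"
  assumes "group E" "group K"
    and ordE: "order E = q ^ 2" and ordK: "order K = q + 2" and q: "q > 0"
    and k0: "k0 \<in> carrier K"
    and L: "\<And>k. k \<in> carrier K - {k0} \<Longrightarrow> subgroup (L k) E \<and> card (L k) = q"
    and cover: "\<And>b. \<lbrakk>b \<in> carrier E; b \<noteq> \<one>\<^bsub>E\<^esub>\<rbrakk> \<Longrightarrow> \<exists>!k. k \<in> carrier K - {k0} \<and> b \<in> L k"
  shows "difference_set (E \<times>\<times> K) (q ^ 2 * (q + 2)) (q * (q + 1)) q
           {(b, k). k \<in> carrier K - {k0} \<and> b \<in> L k}"
proof -
  interpret E: group E by fact
  interpret K: group K by fact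
  interpret EK: group "E \<times>\<times> K" by (intro DirProd_group) fact+
  have finE: "finite (carrier E)" and finK: "finite (carrier K)"
    using ordE ordK q E.order_gt_0_iff_finite K.order_gt_0_iff_finite by simp_all
  have Lc: "x \<in> carrier E" if "x \<in> L k" "k \<in> carrier K - {k0}" for x k
    using subgroup.mem_carrier[OF conjunct1[OF L[OF that(2)]] that(1)] .
  let ?D = "{(b, k). k \<in> carrier K - {k0} \<and> b \<in> L k}"
  have card_fibred: "card {(b, k). k \<in> I \<and> b \<in> S k} = (\<Sum>k\<in>I. card (S k))"
    if "finite I" "\<And>k. k \<in> I \<Longrightarrow> finite (S k)" for I :: "'k set" and S :: "'k \<Rightarrow> 'a set"
  proof -
    have "{(b, k). k \<in> I \<and> b \<in> S k} = prod.swap ` (SIGMA k:I. S k)"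
      by force
    then show ?thesis
      using that by (simp add: card_image card_SigmaI)
  qed
  have finL: "finite (L k)" if "k \<in> carrier K - {k0}" for k
    using Lc[OF _ that] finE by (meson finite_subset subsetI)
  have card_index: "card (carrier K - {k0}) = q + 1"
    using k0 ordK finK by (simp add: order_def)
  show ?thesis
  proof (rule EK.difference_setI)
    show "finite (carrier (E \<times>\<times> K))" "order (E \<times>\<times> K) = q ^ 2 * (q + 2)"
      using finE finK ordE ordK by (auto simp: order_def card_cartesian_product)
    show "?D \<subseteq> carrier (E \<times>\<times> K)"
      using Lc by auto
    have "card ?D = (\<Sum>k\<in>carrier K - {k0}. card (L k))"
      using card_fibred[of "carrier K - {k0}" L] finK finL by simp
    also have "\<dots> = (\<Sum>k\<in>carrier K - {k0}. q)"
      using L by (intro sum.cong) auto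
    finally show "card ?D = q * (q + 1)"
      using card_index by simp
  next
    fix g
    assume "g \<in> carrier (E \<times>\<times> K)" and g1: "g \<noteq> \<one>\<^bsub>E \<times>\<times> K\<^esub>"
    then obtain b c where g: "g = (b, c)" "b \<in> carrier E" "c \<in> carrier K"
      by auto
    show "card {h \<in> ?D. g \<otimes>\<^bsub>E \<times>\<times> K\<^esub> h \<in> ?D} = q"
    proof (cases "c = \<one>\<^bsub>K\<^esub>")
      case True
      then have "b \<noteq> \<one>\<^bsub>E\<^esub>"
        using g g1 by simp
      then obtain k where k: "k \<in> carrier K - {k0}" "b \<in> L k"
        and uniq: "\<And>k'. \<lbrakk>k' \<in> carrier K - {k0}; b \<in> L k'\<rbrakk> \<Longrightarrow> k' = k"
        using cover[OF g(2)] by blast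
      have translate: "b \<otimes>\<^bsub>E\<^esub> x \<in> L k' \<longleftrightarrow> b \<in> L k'" if "k' \<in> carrier K - {k0}" "x \<in> L k'" for x k'
      proof
        assume "b \<otimes>\<^bsub>E\<^esub> x \<in> L k'"
        then have "(b \<otimes>\<^bsub>E\<^esub> x) \<otimes>\<^bsub>E\<^esub> inv\<^bsub>E\<^esub> x \<in> L k'"
          using L that by (meson subgroup.m_closed subgroup.m_inv_closed)
        then show "b \<in> L k'"
          using Lc that g by (simp add: E.m_assoc)
      qed (use L that in \<open>meson subgroup.m_closed\<close>)
      have "(x, k') \<in> {h \<in> ?D. g \<otimes>\<^bsub>E \<times>\<times> K\<^esub> h \<in> ?D} \<longleftrightarrow> (x, k') \<in> L k \<times> {k}" for x k'
      proof -
        have "(x, k') \<in> {h \<in> ?D. g \<otimes>\<^bsub>E \<times>\<times> K\<^esub> h \<in> ?D}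
            \<longleftrightarrow> k' \<in> carrier K - {k0} \<and> x \<in> L k' \<and> b \<otimes>\<^bsub>E\<^esub> x \<in> L k'"
          using True g by auto
        also have "\<dots> \<longleftrightarrow> k' \<in> carrier K - {k0} \<and> x \<in> L k' \<and> b \<in> L k'"
          using translate by blast
        also have "\<dots> \<longleftrightarrow> (x, k') \<in> L k \<times> {k}"
          using uniq k by blast
        finally show ?thesis .
      qed
      then have "{h \<in> ?D. g \<otimes>\<^bsub>E \<times>\<times> K\<^esub> h \<in> ?D} = L k \<times> {k}"
        by (intro subset_antisym subrelI) (simp_all only:)
      then show ?thesis
        using L[OF k(1)] by (simp add: card_cartesian_product)
    next
      case False
      let ?I = "carrier K - {k0, inv\<^bsub>K\<^esub> c \<otimes>\<^bsub>K\<^esub> k0}"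
      let ?S = "\<lambda>k. {x \<in> L k. b \<otimes>\<^bsub>E\<^esub> x \<in> L (c \<otimes>\<^bsub>K\<^esub> k)}"
      have ck: "c \<otimes>\<^bsub>K\<^esub> k \<noteq> k0 \<longleftrightarrow> k \<noteq> inv\<^bsub>K\<^esub> c \<otimes>\<^bsub>K\<^esub> k0" if "k \<in> carrier K" for k
        using that g k0 K.inv_solve_left[of k c k0] by auto
      have "inv\<^bsub>K\<^esub> c \<otimes>\<^bsub>K\<^esub> k0 \<noteq> k0"
        using False g k0 by simp
      then have cardI: "card ?I = q"
        using card_index k0 g by (simp add: card_Diff_insert finK)
      have one: "card (?S k) = 1" if k: "k \<in> ?I" for k
      proof -
        have kk: "k \<in> carrier K - {k0}" "c \<otimes>\<^bsub>K\<^esub> k \<in> carrier K - {k0}" "c \<otimes>\<^bsub>K\<^esub> k \<noteq> k"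
          using k ck g False by auto
        have "L k \<inter> L (c \<otimes>\<^bsub>K\<^esub> k) = {\<one>\<^bsub>E\<^esub>}"
        proof -
          have "x = \<one>\<^bsub>E\<^esub>" if "x \<in> L k" "x \<in> L (c \<otimes>\<^bsub>K\<^esub> k)" for x
            using cover[of x] that kk Lc by blast
          then show ?thesis
            using L kk by (auto intro: subgroup.one_closed)
        qed
        then have "\<exists>!x. x \<in> L k \<and> b \<otimes>\<^bsub>E\<^esub> x \<in> L (c \<otimes>\<^bsub>K\<^esub> k)"
          using L kk g ordE finE
          by (intro E.ex1_translate_of_complements) (auto simp: power2_eq_square)
        then obtain x where "?S k = {x}"
          by blast
        then show ?thesis
          by simp
      qed
      have "{h \<in> ?D. g \<otimes>\<^bsub>E \<times>\<times> K\<^esub> h \<in> ?D} = {(x, k). k \<in> ?I \<and> x \<in> ?S k}"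
        using g ck by auto
      also have "card \<dots> = (\<Sum>k\<in>?I. card (?S k))"
        using finK finL by (intro card_fibred) auto
      finally show ?thesis
        using one cardI by simp
    qed
  qed
qed

text \<open>In the group ring, with \<open>A\<close> and \<open>B\<close> standing for the sums over the two factors, the set is
  \<open>A + B - 2\<close>, is closed under inversion, and has square \<open>4 A + 4 B + 2 A B - 4 A - 4 B + 4 = 4 + 2 A B\<close>.
  The factor order 4 is exactly what makes the terms in \<open>A\<close> and \<open>B\<close> cancel.\<close>

lemma difference_set_of_crossing_factors:
  assumes "group A" "group B" and ordA: "order A = 4" and ordB: "order B = 4"
  shows "difference_set (A \<times>\<times> B) 16 6 2
    ((carrier A - {\<one>\<^bsub>A\<^esub>}) \<times> {\<one>\<^bsub>B\<^esub>} \<union> {\<one>\<^bsub>A\<^esub>} \<times> (carrier B - {\<one>\<^bsub>B\<^esub>}))" (is "difference_set _ _ _ _ ?D")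
proof -
  interpret A: group A by fact
  interpret B: group B by fact
  interpret AB: group "A \<times>\<times> B" by (intro DirProd_group) fact+
  have fin: "finite (carrier A)" "finite (carrier B)"
    using ordA ordB A.order_gt_0_iff_finite B.order_gt_0_iff_finite by simp_all
  show ?thesis
  proof (rule AB.difference_setI)
    show "finite (carrier (A \<times>\<times> B))" "order (A \<times>\<times> B) = 16" "?D \<subseteq> carrier (A \<times>\<times> B)"
      using fin ordA ordB by (auto simp: order_def card_cartesian_product)
    have "card ?D = card ((carrier A - {\<one>\<^bsub>A\<^esub>}) \<times> {\<one>\<^bsub>B\<^esub>}) + card ({\<one>\<^bsub>A\<^esub>} \<times> (carrier B - {\<one>\<^bsub>B\<^esub>}))"
      using fin by (intro card_Un_disjoint) auto
    then show "card ?D = 6"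
      using fin ordA ordB by (simp add: card_cartesian_product order_def)
  next
    fix g
    assume "g \<in> carrier (A \<times>\<times> B)" and g1: "g \<noteq> \<one>\<^bsub>A \<times>\<times> B\<^esub>"
    then obtain b c where g: "g = (b, c)" "b \<in> carrier A" "c \<in> carrier B"
      by auto
    have shiftA: "b \<otimes>\<^bsub>A\<^esub> x = \<one>\<^bsub>A\<^esub> \<longleftrightarrow> x = inv\<^bsub>A\<^esub> b" if "x \<in> carrier A" for x
      using that g by (intro A.mult_eq_one_iff)
    have shiftB: "c \<otimes>\<^bsub>B\<^esub> x = \<one>\<^bsub>B\<^esub> \<longleftrightarrow> x = inv\<^bsub>B\<^esub> c" if "x \<in> carrier B" for x
      using that g by (intro B.mult_eq_one_iff)
    have inv_ne: "inv\<^bsub>A\<^esub> b = \<one>\<^bsub>A\<^esub> \<longleftrightarrow> b = \<one>\<^bsub>A\<^esub>" "inv\<^bsub>B\<^esub> c = \<one>\<^bsub>B\<^esub> \<longleftrightarrow> c = \<one>\<^bsub>B\<^esub>"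
      "\<one>\<^bsub>A\<^esub> = inv\<^bsub>A\<^esub> b \<longleftrightarrow> b = \<one>\<^bsub>A\<^esub>" "\<one>\<^bsub>B\<^esub> = inv\<^bsub>B\<^esub> c \<longleftrightarrow> c = \<one>\<^bsub>B\<^esub>"
      using g A.inv_eq_1_iff[of b] B.inv_eq_1_iff[of c] eq_commute[of "\<one>\<^bsub>A\<^esub>"] eq_commute[of "\<one>\<^bsub>B\<^esub>"]
      by blast+
    let ?S = "{h \<in> ?D. g \<otimes>\<^bsub>A \<times>\<times> B\<^esub> h \<in> ?D}"
    consider "b = \<one>\<^bsub>A\<^esub>" "c \<noteq> \<one>\<^bsub>B\<^esub>" | "b \<noteq> \<one>\<^bsub>A\<^esub>" "c = \<one>\<^bsub>B\<^esub>" | "b \<noteq> \<one>\<^bsub>A\<^esub>" "c \<noteq> \<one>\<^bsub>B\<^esub>"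
      using g g1 by auto
    then show "card ?S = 2"
    proof cases
      case 1
      then have "?S = {\<one>\<^bsub>A\<^esub>} \<times> (carrier B - {\<one>\<^bsub>B\<^esub>, inv\<^bsub>B\<^esub> c})"
        using g shiftA shiftB inv_ne by auto
      then show ?thesis
        using 1 g fin ordB by (simp add: card_cartesian_product order_def card_Diff_insert inv_ne)
    next
      case 2
      then have "?S = (carrier A - {\<one>\<^bsub>A\<^esub>, inv\<^bsub>A\<^esub> b}) \<times> {\<one>\<^bsub>B\<^esub>}"
        using g shiftA shiftB inv_ne by auto
      then show ?thesis
        using 2 g fin ordA by (simp add: card_cartesian_product order_def card_Diff_insert inv_ne)
    next
      case 3
      then have "?S = {(inv\<^bsub>A\<^esub> b, \<one>\<^bsub>B\<^esub>), (\<one>\<^bsub>A\<^esub>, inv\<^bsub>B\<^esub> c)}"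
        using g shiftA shiftB inv_ne by auto
      then show ?thesis
        using 3 g by simp
    qed
  qed
qed

section \<open>Isomorphic involutions\<close>

text \<open>Match orbit by orbit: equal numbers of fixed points and equal sizes leave equal numbers of
  2-element orbits.\<close>

lemma equivariant_bij_of_involutions:
  assumes "finite A" "finite B" "card A = card B"
    and "\<And>x. x \<in> A \<Longrightarrow> s x \<in> A \<and> s (s x) = x"
    and "\<And>y. y \<in> B \<Longrightarrow> t y \<in> B \<and> t (t y) = y"
    and "card {x \<in> A. s x = x} = card {y \<in> B. t y = y}"
  shows "\<exists>f. bij_betw f A B \<and> (\<forall>x\<in>A. f (s x) = t (f x))"
  using assms
proof (induction "card A" arbitrary: A B rule: less_induct)
  case less
  note s = less.prems(4) and t = less.prems(5)
  show ?case
  proof (cases "A = {}")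
    case True
    then show ?thesis
      using less.prems(1,2,3) by (auto simp: bij_betw_def)
  next
    case False
    have fixed_empty_iff: "{x \<in> A. s x = x} = {} \<longleftrightarrow> {y \<in> B. t y = y} = {}"
    proof -
      have "card {x \<in> A. s x = x} = 0 \<longleftrightarrow> {x \<in> A. s x = x} = {}"
        using less.prems(1) by (intro card_0_eq) simp
      moreover have "card {y \<in> B. t y = y} = 0 \<longleftrightarrow> {y \<in> B. t y = y} = {}"
        using less.prems(2) by (intro card_0_eq) simp
      ultimately show ?thesis
        using less.prems(6) by simp
    qed
    have "\<exists>x\<in>A. \<exists>y\<in>B. s x = x \<longleftrightarrow> t y = y"
    proof (cases "{x \<in> A. s x = x} = {}")
      case True
      then have "{y \<in> B. t y = y} = {}"
        using fixed_empty_iff by simp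
      moreover have "B \<noteq> {}"
        using False less.prems(1,2,3) by auto
      ultimately show ?thesis
        using True False by auto
    next
      case nonempty: False
      then have "{y \<in> B. t y = y} \<noteq> {}"
        unfolding fixed_empty_iff .
      then show ?thesis
        using nonempty by blast
    qed
    then obtain x y where xy: "x \<in> A" "y \<in> B" "s x = x \<longleftrightarrow> t y = y"
      by blast
    \<comment> \<open>Remove one orbit on each side; it may be a fixed point or a pair.\<close>
    let ?A = "A - {x, s x}" and ?B = "B - {y, t y}"
    have card_orbit: "card {x, s x} = card {y, t y}"
      using xy by (cases "s x = x") (simp_all add: card_insert_if eq_commute)
    have subs: "{x, s x} \<subseteq> A" "{y, t y} \<subseteq> B"
      using xy s t by auto
    have "\<exists>f. bij_betw f ?A ?B \<and> (\<forall>x\<in>?A. f (s x) = t (f x))"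
    proof (rule less.hyps)
      show "card ?A < card A"
        using less.prems(1) xy by (intro psubset_card_mono) auto
      show "finite ?A" "finite ?B"
        using less.prems(1,2) by auto
      show "card ?A = card ?B"
        using card_orbit subs less.prems(3) by (simp add: card_Diff_subset)
      show "\<And>a. a \<in> ?A \<Longrightarrow> s a \<in> ?A \<and> s (s a) = a"
        using s s[OF xy(1)] by force
      show "\<And>b. b \<in> ?B \<Longrightarrow> t b \<in> ?B \<and> t (t b) = b"
        using t t[OF xy(2)] by force
      have "{a \<in> ?A. s a = a} = {a \<in> A. s a = a} - {x}" "{b \<in> ?B. t b = b} = {b \<in> B. t b = b} - {y}"
        using xy s t by auto
      then show "card {a \<in> ?A. s a = a} = card {b \<in> ?B. t b = b}"
        using xy less.prems(6) by (cases "s x = x") simp_all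
    qed
    then obtain f where f: "bij_betw f ?A ?B" "\<And>a. a \<in> ?A \<Longrightarrow> f (s a) = t (f a)"
      by blast
    let ?f = "f(x := y, s x := t y)"
    have "bij_betw ?f (?A \<union> {x, s x}) (?B \<union> {y, t y})"
    proof (rule bij_betw_combine)
      show "bij_betw ?f ?A ?B"
        using f(1) by (rule bij_betw_cong[THEN iffD1, rotated]) auto
      show "bij_betw ?f {x, s x} {y, t y}"
        using xy by (auto simp: bij_betw_def inj_on_def)
    qed auto
    moreover have "?A \<union> {x, s x} = A" "?B \<union> {y, t y} = B"
      using subs by auto
    moreover have "?f (s a) = t (?f a)" if a: "a \<in> A" for a
    proof -
      consider "a = x" | "a = s x" | "a \<in> ?A"
        using a by blast
      then show ?thesis
      proof cases
        case 1
        then show ?thesis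
          using xy(3) by auto
      next
        case 2
        then show ?thesis
          using xy(3) s[OF xy(1)] t[OF xy(2)] by auto
      next
        case 3
        then have "s a \<noteq> x" "s a \<noteq> s x"
          using 3 s[OF xy(1)] s[OF a] by auto
        then show ?thesis using 3 f by auto
      qed
    qed
    ultimately show ?thesis
      by (intro exI[of _ ?f]) simp
  qed
qed

section \<open>Semidirect products and twisted groups\<close>

lemma (in group) mult_AutoGroup:
  assumes "f \<in> auto G" "g \<in> auto G"
  shows "f \<otimes>\<^bsub>AutoGroup G\<^esub> g = compose (carrier G) f g"
  using assms by (simp add: AutoGroup_def BijGroup_def auto_def)

lemma carrier_AutoGroup: "carrier (AutoGroup G) = auto G"
  by (simp add: AutoGroup_def)

lemma one_AutoGroup: "\<one>\<^bsub>AutoGroup G\<^esub> = (\<lambda>x\<in>carrier G. x)"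
  by (simp add: AutoGroup_def BijGroup_def)

text \<open>The action is on the right while \<^const>\<open>AutoGroup\<close> composes on the left; the exchange of the
  factors in the first component of \<^const>\<open>semidirect\<close> is what makes associativity work.\<close>

lemma (in group) semidirect_is_group:
  assumes A: "subgroup A (AutoGroup G)"
  shows "group (semidirect A G)"
proof -
  interpret Aut: group "AutoGroup G"
    by (rule AutoGroup)
  interpret A: subgroup A "AutoGroup G" by fact
  have aut: "f \<in> auto G" if "f \<in> A" for f
    using that A.mem_carrier by (simp add: carrier_AutoGroup)
  have closed: "f x \<in> carrier G" if "f \<in> A" "x \<in> carrier G" for f x
    using aut[OF that(1)] that(2) by (auto simp: auto_def hom_def)
  have hom: "f (x \<otimes> y) = f x \<otimes> f y" if "f \<in> A" "x \<in> carrier G" "y \<in> carrier G" for f x y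
    using aut[OF that(1)] that(2,3) by (auto simp: auto_def hom_def)
  have comp: "(f \<otimes>\<^bsub>AutoGroup G\<^esub> g) x = f (g x)" if "f \<in> A" "g \<in> A" "x \<in> carrier G" for f g x
    using that by (simp add: mult_AutoGroup aut compose_def)
  have one: "\<one>\<^bsub>AutoGroup G\<^esub> x = x" if "x \<in> carrier G" for x
    using that by (simp add: one_AutoGroup)
  have car: "f \<in> carrier (AutoGroup G)" if "f \<in> A" for f
    using that by (rule A.mem_carrier)
  show ?thesis
  proof (rule groupI)
    fix x y
    assume "x \<in> carrier (semidirect A G)" "y \<in> carrier (semidirect A G)"
    then show "x \<otimes>\<^bsub>semidirect A G\<^esub> y \<in> carrier (semidirect A G)"
      using closed by (auto simp: semidirect_def)
  next
    show "\<one>\<^bsub>semidirect A G\<^esub> \<in> carrier (semidirect A G)"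
      by (simp add: semidirect_def)
  next
    fix x y z
    assume "x \<in> carrier (semidirect A G)" "y \<in> carrier (semidirect A G)" "z \<in> carrier (semidirect A G)"
    then show "x \<otimes>\<^bsub>semidirect A G\<^esub> y \<otimes>\<^bsub>semidirect A G\<^esub> z = x \<otimes>\<^bsub>semidirect A G\<^esub> (y \<otimes>\<^bsub>semidirect A G\<^esub> z)"
      using closed by (auto simp: semidirect_def hom comp car Aut.m_assoc m_assoc)
  next
    fix x
    assume "x \<in> carrier (semidirect A G)"
    then show "\<one>\<^bsub>semidirect A G\<^esub> \<otimes>\<^bsub>semidirect A G\<^esub> x = x"
      using closed hom[of "fst x" \<one> \<one>]
      by (auto simp: semidirect_def car)
  next
    fix x
    assume "x \<in> carrier (semidirect A G)"
    then obtain f g where x: "x = (f, g)" "f \<in> A" "g \<in> carrier G"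
      by (auto simp: semidirect_def)
    let ?f = "inv\<^bsub>AutoGroup G\<^esub> f"
    have f': "?f \<in> A"
      using x by simp
    have "f (?f (inv g)) = inv g"
      using comp[OF x(2) f', of "inv g"] one[of "inv g"] x car by simp
    then have "(?f, ?f (inv g)) \<otimes>\<^bsub>semidirect A G\<^esub> x = \<one>\<^bsub>semidirect A G\<^esub>"
      using x car by (simp add: semidirect_def)
    moreover have "(?f, ?f (inv g)) \<in> carrier (semidirect A G)"
      using f' closed x by (simp add: semidirect_def)
    ultimately show "\<exists>y\<in>carrier (semidirect A G). y \<otimes>\<^bsub>semidirect A G\<^esub> x = \<one>\<^bsub>semidirect A G\<^esub>"
      by blast
  qed
qed

text \<open>The data needed for the twist: an involutive automorphism and an invariant subgroup \<open>B0\<close> of index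
  at most 2, the latter expressed by the product of two elements outside \<open>B0\<close> lying inside.\<close>

locale twisting = group B for B (structure) +
  fixes \<psi> :: "'a \<Rightarrow> 'a" and B0 :: "'a set"
  assumes aut: "\<psi> \<in> auto B"
    and involution: "g \<in> carrier B \<Longrightarrow> \<psi> (\<psi> g) = g"
    and subgroup_B0: "subgroup B0 B"
    and mult_outside: "\<lbrakk>g \<in> carrier B - B0; h \<in> carrier B - B0\<rbrakk> \<Longrightarrow> g \<otimes> h \<in> B0"
    and preserves_B0: "g \<in> B0 \<Longrightarrow> \<psi> g \<in> B0"
begin

text \<open>The automorphism that is attached to \<open>g\<close> by the character of \<open>B\<close> with kernel \<open>B0\<close>.\<close>

definition twist_aut :: "'a \<Rightarrow> 'a \<Rightarrow> 'a" where
  "twist_aut g = (if g \<in> B0 then \<one>\<^bsub>AutoGroup B\<^esub> else \<psi>)"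

definition twist :: "'a \<Rightarrow> ('a \<Rightarrow> 'a) \<times> 'a" where
  "twist g = (twist_aut g, g)"

abbreviation ambient :: "(('a \<Rightarrow> 'a) \<times> 'a) monoid" where
  "ambient \<equiv> semidirect (generate (AutoGroup B) {\<psi>}) B"

abbreviation twisted :: "(('a \<Rightarrow> 'a) \<times> 'a) monoid" where
  "twisted \<equiv> ambient\<lparr>carrier := twist ` carrier B\<rparr>"

lemma psi_closed: "g \<in> carrier B \<Longrightarrow> \<psi> g \<in> carrier B"
  using aut by (auto simp: auto_def hom_def)

lemma psi_mult: "\<lbrakk>g \<in> carrier B; h \<in> carrier B\<rbrakk> \<Longrightarrow> \<psi> (g \<otimes> h) = \<psi> g \<otimes> \<psi> h"
  using aut by (auto simp: auto_def hom_def)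

lemma B0_carrier: "g \<in> B0 \<Longrightarrow> g \<in> carrier B"
  using subgroup_B0 by (rule subgroup.mem_carrier)

lemma one_B0: "\<one> \<in> B0"
  using subgroup_B0 by (rule subgroup.one_closed)

lemma mult_in_B0_iff:
  assumes g: "g \<in> carrier B" and h: "h \<in> carrier B"
  shows "g \<otimes> h \<in> B0 \<longleftrightarrow> (g \<in> B0 \<longleftrightarrow> h \<in> B0)"
proof -
  have "h \<in> B0" if "g \<in> B0" "g \<otimes> h \<in> B0"
  proof -
    have "inv g \<otimes> (g \<otimes> h) \<in> B0"
      using that subgroup_B0 by (meson subgroup.m_closed subgroup.m_inv_closed)
    then show ?thesis
      using g h by (simp add: m_assoc[symmetric])
  qed
  moreover have "g \<in> B0" if "h \<in> B0" "g \<otimes> h \<in> B0"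
  proof -
    have "(g \<otimes> h) \<otimes> inv h \<in> B0"
      using that subgroup_B0 by (meson subgroup.m_closed subgroup.m_inv_closed)
    then show ?thesis
      using g h by (simp add: m_assoc)
  qed
  moreover have "g \<otimes> h \<in> B0" if "g \<in> B0" "h \<in> B0"
    using that subgroup_B0 by (meson subgroup.m_closed)
  ultimately show ?thesis
    using mult_outside g h by blast
qed

lemma psi_in_B0_iff: "g \<in> carrier B \<Longrightarrow> \<psi> g \<in> B0 \<longleftrightarrow> g \<in> B0"
  using preserves_B0 involution by metis

lemma twist_aut_apply: "x \<in> carrier B \<Longrightarrow> twist_aut g x = (if g \<in> B0 then x else \<psi> x)"
  by (simp add: twist_aut_def one_AutoGroup)

lemma twist_aut_closed: "x \<in> carrier B \<Longrightarrow> twist_aut g x \<in> carrier B"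
  by (simp add: twist_aut_apply psi_closed)

lemma twist_aut_involution: "x \<in> carrier B \<Longrightarrow> twist_aut g (twist_aut g x) = x"
  by (simp add: twist_aut_apply psi_closed involution)

lemma twist_aut_in_B0_iff: "x \<in> carrier B \<Longrightarrow> twist_aut g x \<in> B0 \<longleftrightarrow> x \<in> B0"
  by (simp add: twist_aut_apply psi_in_B0_iff)

lemma psi_generates: "subgroup (generate (AutoGroup B) {\<psi>}) (AutoGroup B)"
  using aut by (intro group.generate_is_subgroup AutoGroup) (simp add: carrier_AutoGroup)

lemma ambient_group: "group ambient"
  by (intro semidirect_is_group psi_generates)

lemma twist_aut_mem: "twist_aut g \<in> generate (AutoGroup B) {\<psi>}"
  by (simp add: twist_aut_def generate.one generate.incl)

lemma psi_psi: "\<psi> \<otimes>\<^bsub>AutoGroup B\<^esub> \<psi> = \<one>\<^bsub>AutoGroup B\<^esub>"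
proof -
  have "compose (carrier B) \<psi> \<psi> = (\<lambda>x\<in>carrier B. x)"
    using involution by (auto simp: compose_def restrict_def)
  then show ?thesis
    using aut by (simp add: mult_AutoGroup one_AutoGroup)
qed

text \<open>Closure of the twisted set: an application of \<open>\<psi>\<close> does not change membership in \<open>B0\<close>, so the
  attached automorphisms multiply in the same way as the cosets of \<open>B0\<close>.\<close>

lemma twist_mult:
  assumes "x \<in> carrier B" "h \<in> carrier B"
  shows "twist x \<otimes>\<^bsub>ambient\<^esub> twist h = twist (twist_aut h x \<otimes> h)"
proof -
  interpret Aut: group "AutoGroup B"
    by (rule AutoGroup)
  have "\<psi> \<in> carrier (AutoGroup B)"
    using aut by (simp add: carrier_AutoGroup)
  moreover have "twist_aut h x \<otimes> h \<in> B0 \<longleftrightarrow> (x \<in> B0 \<longleftrightarrow> h \<in> B0)"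
    using assms by (simp add: mult_in_B0_iff twist_aut_closed twist_aut_in_B0_iff)
  ultimately have "twist_aut h \<otimes>\<^bsub>AutoGroup B\<^esub> twist_aut x = twist_aut (twist_aut h x \<otimes> h)"
    by (auto simp: twist_aut_def psi_psi)
  then show ?thesis
    by (simp add: twist_def semidirect_def)
qed

lemma twist_one: "twist \<one> = \<one>\<^bsub>ambient\<^esub>"
  by (simp add: twist_def semidirect_def twist_aut_def one_B0)

lemma twist_carrier: "x \<in> carrier B \<Longrightarrow> twist x \<in> carrier ambient"
  by (simp add: twist_def semidirect_def twist_aut_mem)

lemma inj_twist: "inj twist"
  by (simp add: inj_def twist_def)

lemma twist_inv:
  assumes "x \<in> carrier B"
  shows "inv\<^bsub>ambient\<^esub> (twist x) = twist (twist_aut x (inv x))"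
proof (rule group.inv_equality[OF ambient_group])
  show "twist (twist_aut x (inv x)) \<otimes>\<^bsub>ambient\<^esub> twist x = \<one>\<^bsub>ambient\<^esub>"
    using assms by (simp add: twist_mult twist_aut_closed twist_aut_involution twist_one)
qed (use assms in \<open>simp_all add: twist_carrier twist_aut_closed\<close>)

lemma subgroup_twisted: "subgroup (twist ` carrier B) ambient"
proof (rule group.subgroupI[OF ambient_group])
  show "twist ` carrier B \<subseteq> carrier ambient"
    using twist_carrier by blast
  show "twist ` carrier B \<noteq> {}"
    by auto
  show "inv\<^bsub>ambient\<^esub> a \<in> twist ` carrier B" if "a \<in> twist ` carrier B" for a
    using that by (auto simp: twist_inv twist_aut_closed)
  show "a \<otimes>\<^bsub>ambient\<^esub> b \<in> twist ` carrier B" if "a \<in> twist ` carrier B" "b \<in> twist ` carrier B" for a b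
    using that by (auto simp: twist_mult twist_aut_closed)
qed

lemma twisted_group: "group twisted"
  using group.subgroup_imp_group[OF ambient_group subgroup_twisted] .

lemma order_twisted: "order twisted = order B"
  by (simp add: order_def card_image inj_on_subset[OF inj_twist])

text \<open>The count for \<open>twist x\<close> runs over the \<open>h \<in> D\<close> with \<open>x\<^sup>\<alpha> h \<in> D\<close>, where \<open>\<alpha>\<close> is the automorphism
  attached to \<open>h\<close>. Since \<open>D\<close> is invariant, \<open>\<alpha>\<close> may be applied to this condition, which turns it into
  \<open>x h\<^sup>\<alpha> \<in> D\<close>; and \<open>h \<mapsto> h\<^sup>\<alpha>\<close> is a permutation of \<open>D\<close>, inverse to itself because it respects \<open>B0\<close>.
  So the count is the one for \<open>x\<close> in \<open>B\<close>.\<close>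

lemma difference_set_twist:
  assumes D: "difference_set B v k l D" and inv: "\<And>g. g \<in> D \<Longrightarrow> \<psi> g \<in> D"
  shows "difference_set twisted v k l (twist ` D)"
proof -
  interpret T: group twisted
    by (rule twisted_group)
  have Dc: "D \<subseteq> carrier B" and fin: "finite (carrier B)" and ord: "order B = v"
    and card: "card D = k"
    using D by (simp_all add: difference_set_def)
  have act_D: "twist_aut g h \<in> D \<longleftrightarrow> h \<in> D" if "h \<in> carrier B" for g h
    using that inv involution by (metis twist_aut_apply)
  show ?thesis
  proof (rule T.difference_setI)
    show "finite (carrier twisted)" "order twisted = v" "twist ` D \<subseteq> carrier twisted"
      using fin ord Dc order_twisted by auto
    show "card (twist ` D) = k"
      using card by (simp add: card_image inj_on_subset[OF inj_twist])
  next
    fix g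
    assume g: "g \<in> carrier twisted" "g \<noteq> \<one>\<^bsub>twisted\<^esub>"
    then obtain x where "g = twist x" "x \<in> carrier B"
      by auto
    moreover from this have "x \<noteq> \<one>"
      using g(2) twist_one by force
    ultimately have x: "g = twist x" "x \<in> carrier B" "x \<noteq> \<one>"
      by simp_all
    have mem: "g \<otimes>\<^bsub>twisted\<^esub> twist h \<in> twist ` D \<longleftrightarrow> twist_aut h x \<otimes> h \<in> D" if "h \<in> D" for h
    proof -
      have "g \<otimes>\<^bsub>twisted\<^esub> twist h = twist (twist_aut h x \<otimes> h)"
        using x that Dc by (simp add: twist_mult subsetD)
      then show ?thesis
        by (simp only: inj_image_mem_iff[OF inj_twist])
    qed
    have "{h \<in> twist ` D. g \<otimes>\<^bsub>twisted\<^esub> h \<in> twist ` D}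
        = twist ` {h \<in> D. g \<otimes>\<^bsub>twisted\<^esub> twist h \<in> twist ` D}"
      by blast
    also have "{h \<in> D. g \<otimes>\<^bsub>twisted\<^esub> twist h \<in> twist ` D} = {h \<in> D. twist_aut h x \<otimes> h \<in> D}"
      using mem by blast
    finally have "card {h \<in> twist ` D. g \<otimes>\<^bsub>twisted\<^esub> h \<in> twist ` D} = card {h \<in> D. twist_aut h x \<otimes> h \<in> D}"
      by (simp add: card_image inj_on_subset[OF inj_twist])
    also have "\<dots> = card {h \<in> D. x \<otimes> h \<in> D}"
    proof (rule bij_betw_same_card)
      have idem: "twist_aut (twist_aut h h) = twist_aut h" if "h \<in> carrier B" for h
      proof -
        have "twist_aut g = twist_aut h" if "g \<in> B0 \<longleftrightarrow> h \<in> B0" for g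
          using that by (simp add: twist_aut_def)
        then show ?thesis
          using that twist_aut_in_B0_iff by blast
      qed
      \<comment> \<open>The automorphism attached to \<open>h\<close> depends on the coset of \<open>h\<close> only, which it preserves, and it is an
  involution; so it can be moved between the factors of the condition in either direction.\<close>
      have push: "twist_aut h x \<otimes> h = twist_aut h (x \<otimes> twist_aut h h)" if "h \<in> carrier B" for h
        using that x by (simp add: twist_aut_apply psi_closed psi_mult involution)
      have pull: "twist_aut h x \<otimes> twist_aut h h = twist_aut h (x \<otimes> h)" if "h \<in> carrier B" for h
        using that x by (simp add: twist_aut_apply psi_closed psi_mult involution)
      show "bij_betw (\<lambda>h. twist_aut h h) {h \<in> D. twist_aut h x \<otimes> h \<in> D} {h \<in> D. x \<otimes> h \<in> D}"
      proof (rule bij_betw_byWitness[where f' = "\<lambda>h. twist_aut h h"])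
        show "\<forall>h\<in>{h \<in> D. twist_aut h x \<otimes> h \<in> D}. twist_aut (twist_aut h h) (twist_aut h h) = h"
          "\<forall>h\<in>{h \<in> D. x \<otimes> h \<in> D}. twist_aut (twist_aut h h) (twist_aut h h) = h"
          using Dc by (auto simp: idem twist_aut_involution)
        show "(\<lambda>h. twist_aut h h) ` {h \<in> D. twist_aut h x \<otimes> h \<in> D} \<subseteq> {h \<in> D. x \<otimes> h \<in> D}"
          using Dc x by (auto simp: act_D push twist_aut_closed)
        show "(\<lambda>h. twist_aut h h) ` {h \<in> D. x \<otimes> h \<in> D} \<subseteq> {h \<in> D. twist_aut h x \<otimes> h \<in> D}"
          using Dc x by (auto simp: act_D idem pull twist_aut_closed)
      qed
    qed
    also have "\<dots> = l"
      using D x difference_set_iff_translates[OF fin Dc] by blast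
    finally show "card {h \<in> twist ` D. g \<otimes>\<^bsub>twisted\<^esub> h \<in> twist ` D} = l" .
  qed
qed

text \<open>On \<open>B0\<close> the twist is the ordinary embedding \<open>x \<mapsto> (1, x)\<close>, so generators of \<open>B0\<close> produce all of
  \<open>twist ` B0\<close>; one element over the other coset then reaches everything.\<close>

lemma generate_twist:
  assumes Y: "generate B Y = B0" and t: "t \<in> carrier B" "t \<notin> B0"
  shows "generate ambient (insert (twist t) ((\<lambda>x. (\<one>\<^bsub>AutoGroup B\<^esub>, x)) ` Y)) = twist ` carrier B"
    (is "generate _ ?Y = _")
proof -
  interpret S: group ambient
    by (rule ambient_group)
  have XB0: "Y \<subseteq> B0"
    using Y generate.incl by (metis subsetI)
  then have X_twist: "(\<one>\<^bsub>AutoGroup B\<^esub>, x) = twist x" if "x \<in> Y" for x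
    using that by (auto simp: twist_def twist_aut_def)
  have sub: "?Y \<subseteq> twist ` carrier B"
    using X_twist XB0 B0_carrier t by auto
  have "?Y \<subseteq> carrier ambient"
    using sub subgroup.subset[OF subgroup_twisted] by (rule order_trans)
  then interpret gen: subgroup "generate ambient ?Y" ambient
    by (rule S.generate_is_subgroup)
  have B0_gen: "twist b \<in> generate ambient ?Y" if "b \<in> B0" for b
  proof -
    have "b \<in> generate B Y"
      using that Y by simp
    then show ?thesis
    proof induction
      case one
      then show ?case
        by (simp add: twist_one)
    next
      case (incl h)
      then show ?case
        using X_twist by (metis generate.incl imageI insertCI)
    next
      case (inv h)
      then have h: "h \<in> B0" "h \<in> carrier B"
        using XB0 B0_carrier by auto
      have "twist h \<in> generate ambient ?Y"
        using inv X_twist by (metis generate.incl imageI insertCI)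
      then have "inv\<^bsub>ambient\<^esub> (twist h) \<in> generate ambient ?Y"
        by simp
      then show ?case
        using h by (simp add: twist_inv twist_aut_apply)
    next
      case (eng h1 h2)
      then have h: "h1 \<in> B0" "h2 \<in> B0"
        using Y by auto
      then have "twist h1 \<otimes>\<^bsub>ambient\<^esub> twist h2 = twist (h1 \<otimes> h2)"
        by (simp add: twist_mult B0_carrier twist_aut_apply)
      then show ?case
        using eng gen.m_closed by metis
    qed
  qed
  have "twist b \<in> generate ambient ?Y" if b: "b \<in> carrier B" for b
  proof (cases "b \<in> B0")
    case False
    have "inv t \<otimes> b \<in> B0"
    proof -
      have "inv t \<notin> B0"
        using t subgroup.m_inv_closed[OF subgroup_B0, of "inv t"] by auto
      then show ?thesis
        using t b False by (intro mult_outside) auto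
    qed
    then have "twist t \<otimes>\<^bsub>ambient\<^esub> twist (inv t \<otimes> b) \<in> generate ambient ?Y"
      using B0_gen by (intro gen.m_closed) (auto intro: generate.incl)
    also have "twist t \<otimes>\<^bsub>ambient\<^esub> twist (inv t \<otimes> b) = twist b"
      using \<open>inv t \<otimes> b \<in> B0\<close> t b by (simp add: twist_mult twist_aut_apply m_assoc[symmetric])
    finally show ?thesis .
  qed (rule B0_gen)
  then show ?thesis
    using S.generate_subgroup_incl[OF sub subgroup_twisted] by auto
qed

end

section \<open>Dihedral groups\<close>

locale dihedral = group K for K (structure) +
  fixes n :: nat and y u
  assumes presentation: "dihedral_presentation K n y u"
    and n_pos: "n > 0"
begin

lemma order_K: "order K = 2 * n"
  and y_closed [simp]: "y \<in> carrier K" and u_closed [simp]: "u \<in> carrier K"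
  and generate_yu: "generate K {y, u} = carrier K"
  and y_pow_n: "y [^] n = \<one>"
  using presentation by (auto simp: dihedral_presentation_def)

lemma finite_K: "finite (carrier K)"
  using order_K n_pos order_gt_0_iff_finite by simp

lemma u_u [simp]: "u \<otimes> u = \<one>"
  using presentation by (simp add: dihedral_presentation_def numeral_2_eq_2)

lemma inv_u [simp]: "inv u = u"
  by (rule inv_equality) simp_all

lemma u_u_assoc [simp]: "k \<in> carrier K \<Longrightarrow> u \<otimes> (u \<otimes> k) = k"
  by (simp add: m_assoc[symmetric])

lemma u_y: "u \<otimes> y = inv y \<otimes> u"
proof -
  have "u \<otimes> y \<otimes> u = inv y"
    using presentation by (simp add: dihedral_presentation_def)
  then have "u \<otimes> y \<otimes> u \<otimes> u = inv y \<otimes> u"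
    by simp
  then show ?thesis
    by (simp add: m_assoc)
qed

lemma u_y_pow: "u \<otimes> y [^] (i::nat) = inv (y [^] i) \<otimes> u"
proof (induction i)
  case (Suc i)
  have "u \<otimes> y [^] Suc i = (u \<otimes> y [^] i) \<otimes> y"
    by (simp add: m_assoc)
  also have "\<dots> = inv (y [^] i) \<otimes> (u \<otimes> y)"
    by (simp add: Suc m_assoc)
  also have "\<dots> = inv (y \<otimes> y [^] i) \<otimes> u"
    by (simp add: u_y inv_mult_group m_assoc)
  also have "y \<otimes> y [^] i = y [^] Suc i"
    by (rule nat_pow_Suc2[symmetric]) simp
  finally show ?case .
qed simp

lemma inv_y_pow: "inv (y [^] (i::nat)) = y [^] ((n - 1) * i)"
proof (rule inv_equality)
  have "(n - 1) * i + i = n * i"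
    using n_pos by (cases n) simp_all
  then have "y [^] ((n - 1) * i) \<otimes> y [^] i = y [^] (n * i)"
    by (simp add: nat_pow_mult)
  then show "y [^] ((n - 1) * i) \<otimes> y [^] i = \<one>"
    by (simp add: y_pow_n flip: nat_pow_pow)
qed simp_all

lemma y_pow_pow_n: "(y [^] (i::nat)) [^] n = \<one>"
  using y_pow_n by (metis mult.commute nat_pow_one nat_pow_pow y_closed)

lemma elements:
  assumes "k \<in> carrier K"
  obtains (rotation) i :: nat where "k = y [^] i" | (reflection) i :: nat where "k = y [^] i \<otimes> u"
proof -
  have "k \<in> generate K {y, u}"
    using assms generate_yu by simp
  then have "\<exists>i::nat. k = y [^] i \<or> k = y [^] i \<otimes> u"
  proof induction
    case one
    then show ?case
      by (intro exI[of _ 0]) simp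
  next
    case (incl h)
    then consider "h = y [^] (1::nat)" | "h = y [^] (0::nat) \<otimes> u"
      by auto
    then show ?case
      by cases blast+
  next
    case (inv h)
    then consider "inv h = y [^] ((n - 1) * 1)" | "inv h = y [^] (0::nat) \<otimes> u"
      using inv_y_pow[of 1] by auto
    then show ?case
      by cases blast+
  next
    case (eng h1 h2)
    then obtain i j :: nat where ij: "h1 = y [^] i \<or> h1 = y [^] i \<otimes> u" "h2 = y [^] j \<or> h2 = y [^] j \<otimes> u"
      by blast
    \<comment> \<open>Moving \<open>u\<close> to the right inverts the power of \<open>y\<close>, and \<open>y\<^sup>-\<^sup>j = y\<^bsup>(n-1)j\<^esup>\<close>.\<close>
    have swap: "y [^] i \<otimes> u \<otimes> y [^] j = y [^] (i + (n - 1) * j) \<otimes> u"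
    proof -
      have "y [^] i \<otimes> u \<otimes> y [^] j = y [^] i \<otimes> (u \<otimes> y [^] j)"
        by (simp add: m_assoc)
      also have "\<dots> = y [^] i \<otimes> y [^] ((n - 1) * j) \<otimes> u"
        by (simp only: u_y_pow inv_y_pow) (simp add: m_assoc)
      finally show ?thesis
        by (simp add: nat_pow_mult)
    qed
    have "y [^] i \<otimes> u \<otimes> (y [^] j \<otimes> u) = y [^] (i + (n - 1) * j)"
      using swap by (simp add: m_assoc[symmetric]) (simp add: m_assoc)
    moreover have "y [^] i \<otimes> (y [^] j \<otimes> u) = y [^] (i + j) \<otimes> u"
      by (simp add: m_assoc[symmetric] nat_pow_mult)
    moreover have "y [^] i \<otimes> y [^] j = y [^] (i + j)"
      by (simp add: nat_pow_mult)
    ultimately show ?case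
      using ij swap by metis
  qed
  then show thesis
    using that by blast
qed

end

locale odd_dihedral = dihedral +
  assumes n_odd: "odd n" and n_gt_1: "n > 1"
begin

text \<open>Otherwise \<open>K\<close> would consist of \<open>1\<close> and \<open>u\<close> only, which is too small.\<close>

lemma y_ne_one: "y \<noteq> \<one>"
proof
  assume y: "y = \<one>"
  have "k \<in> {\<one>, u}" if "k \<in> carrier K" for k
    using that by (cases rule: elements) (simp_all add: y)
  then have "carrier K \<subseteq> {\<one>, u}"
    by blast
  then have "card (carrier K) \<le> card {\<one>, u}"
    by (intro card_mono) simp_all
  also have "\<dots> \<le> 2"
    by (simp add: card_insert_if)
  finally show False
    using order_K n_gt_1 by (simp add: order_def)
qed

text \<open>The rotations form a group of odd exponent \<open>n\<close>.\<close>

lemma rotation_trivial: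
  assumes "(y [^] (i::nat)) [^] (2 ^ a :: nat) = \<one>"
  shows "y [^] i = \<one>"
  using eq_one_if_coprime_exponents[OF _ assms y_pow_pow_n] n_odd by simp

lemma rotation_squared_trivial:
  assumes "y [^] (i::nat) \<otimes> y [^] i = \<one>"
  shows "y [^] i = \<one>"
  using rotation_trivial[of i 1] assms by (simp add: numeral_2_eq_2)

lemma u_ne_one: "u \<noteq> \<one>"
proof
  assume "u = \<one>"
  then have "y = inv y"
    using u_y by simp
  then have "y \<otimes> y = \<one>"
    using r_inv[of y] by simp
  then show False
    using rotation_squared_trivial[of 1] y_ne_one by simp
qed

text \<open>A power of \<open>y\<close> that commutes with \<open>u\<close> equals its own inverse, hence is trivial as \<open>n\<close> is odd.\<close>

lemma centralizer_u:
  assumes k: "k \<in> carrier K" and comm: "u \<otimes> k \<otimes> u = k"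
  shows "k = \<one> \<or> k = u"
proof -
  have rot: "y [^] i = \<one>" if "u \<otimes> y [^] i = y [^] i \<otimes> u" for i :: nat
  proof -
    have "inv (y [^] i) = y [^] i"
      using that u_y_pow[of i] by simp
    then have "y [^] i \<otimes> y [^] i = \<one>"
      using r_inv[of "y [^] i"] by simp
    then show ?thesis
      by (rule rotation_squared_trivial)
  qed
  from k show ?thesis
  proof (cases rule: elements)
    case (rotation i)
    have "u \<otimes> y [^] i \<otimes> u \<otimes> u = y [^] i \<otimes> u"
      using comm rotation by simp
    then have "u \<otimes> y [^] i = y [^] i \<otimes> u"
      by (simp add: m_assoc)
    then show ?thesis
      using rot rotation by blast
  next
    case (reflection i)
    have "u \<otimes> y [^] i = y [^] i \<otimes> u"
      using comm reflection by (simp add: m_assoc)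
    then show ?thesis
      using rot reflection by simp
  qed
qed

text \<open>The elementwise form of the fact that \<open>K\<close> has no nontrivial normal 2-subgroup: such a subgroup
  would contain, along with a reflection, its commutator with \<open>y\<close>, which is the rotation \<open>y\<^sup>2\<close> of odd
  order.\<close>

lemma two_core_trivial:
  assumes k: "k \<in> carrier K" "k [^] (2 ^ a :: nat) = \<one>"
    and comm: "(y \<otimes> k \<otimes> inv y \<otimes> inv k) [^] (2 ^ a :: nat) = \<one>"
  shows "k = \<one>"
  using k(1)
proof (cases rule: elements)
  case (rotation i)
  then show ?thesis
    using rotation_trivial k(2) by blast
next
  case (reflection i)
  have uyu: "u \<otimes> (inv y \<otimes> (u \<otimes> z)) = y \<otimes> z" if "z \<in> carrier K" for z
  proof -
    have "u \<otimes> (inv y \<otimes> (u \<otimes> z)) = u \<otimes> (inv y \<otimes> u) \<otimes> z"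
      using that by (simp add: m_assoc)
    also have "inv y \<otimes> u = u \<otimes> y"
      by (simp add: u_y)
    finally show ?thesis
      using that by (simp add: m_assoc)
  qed
  have "y \<otimes> k \<otimes> inv y \<otimes> inv k = y \<otimes> (y [^] i \<otimes> (y \<otimes> inv (y [^] i)))"
    using reflection by (simp add: inv_mult_group m_assoc uyu)
  also have "y [^] i \<otimes> (y \<otimes> inv (y [^] i)) = y"
  proof -
    have "y [^] i \<otimes> y = y \<otimes> y [^] i"
      using nat_pow_Suc2[of y i] by simp
    then have "y [^] i \<otimes> (y \<otimes> inv (y [^] i)) = y \<otimes> y [^] i \<otimes> inv (y [^] i)"
      by (simp add: m_assoc[symmetric])
    then show ?thesis
      by (simp add: m_assoc)
  qed
  finally have "(y \<otimes> y) [^] (2 ^ a :: nat) = \<one>"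
    using comm by simp
  then have "(y [^] (2::nat)) [^] (2 ^ a :: nat) = \<one>"
    by (simp add: numeral_2_eq_2)
  then have "y [^] (2::nat) = \<one>"
    by (rule rotation_trivial)
  then show ?thesis
    using rotation_squared_trivial[of 1] y_ne_one by (simp add: numeral_2_eq_2)
qed

end

section \<open>Lines in the plane over a finite field of characteristic 2\<close>

locale binary_field = field F for F :: "('f, 'm) ring_scheme" (structure) +
  fixes d :: nat
  assumes order_F: "order F = 2 ^ d" and d_pos: "d \<ge> 1"
begin

lemma finite_F: "finite (carrier F)"
  using order_F add.order_gt_0_iff_finite by (simp add: order_def)

text \<open>The multiplicative group has odd order \<open>2\<^sup>d - 1\<close>. Besides the uniqueness of the line fixed by the
  swap, this yields characteristic 2, as \<open>-1\<close> squares to \<open>1\<close>.\<close>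

lemma square_eq_one:
  assumes m: "m \<in> carrier F" and sq: "m \<otimes> m = \<one>"
  shows "m = \<one>"
proof -
  interpret M: group "Multiplicative_Group.mult_of F"
    by (rule field_mult_group)
  have m': "m \<in> carrier (Multiplicative_Group.mult_of F)"
    using m sq by auto
  have "m [^]\<^bsub>Multiplicative_Group.mult_of F\<^esub> (2::nat) = \<one>\<^bsub>Multiplicative_Group.mult_of F\<^esub>"
    using sq m by (simp add: numeral_2_eq_2)
  moreover have "m [^]\<^bsub>Multiplicative_Group.mult_of F\<^esub> ((2::nat) ^ d - 1) = \<one>\<^bsub>Multiplicative_Group.mult_of F\<^esub>"
    using M.pow_order_eq_1[OF m'] order_mult_of[OF finite_F] order_F by simp
  moreover have "coprime (2::nat) (2 ^ d - 1)"
    using d_pos by (cases d) simp_all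
  ultimately have "m = \<one>\<^bsub>Multiplicative_Group.mult_of F\<^esub>"
    by (rule M.eq_one_if_coprime_exponents[OF m'])
  then show ?thesis
    by simp
qed

lemma add_self:
  assumes x: "x \<in> carrier F"
  shows "x \<oplus> x = \<zero>"
proof -
  have "\<ominus> \<one> = \<one>"
    by (rule square_eq_one) (simp_all add: l_minus)
  then have "\<ominus> x = x"
    using x by (metis l_minus l_one one_closed)
  then show ?thesis
    using x r_neg by force
qed

lemma group_E_simps:
  "carrier (group_E F) = carrier F \<times> carrier F"
  "(a, b) \<otimes>\<^bsub>group_E F\<^esub> (a', b') = (a \<oplus> a', b \<oplus> b')"
  "\<one>\<^bsub>group_E F\<^esub> = (\<zero>, \<zero>)"
  by (simp_all add: group_E_def)

lemma group_E_comm_group: "comm_group (group_E F)"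
proof -
  have "group (group_E F)"
    unfolding group_E_def by (intro DirProd_group add.is_group)
  then show ?thesis
    by (rule group.group_comm_groupI) (auto simp: group_E_simps a_comm)
qed

lemma group_E_square: "b \<in> carrier (group_E F) \<Longrightarrow> b \<otimes>\<^bsub>group_E F\<^esub> b = \<one>\<^bsub>group_E F\<^esub>"
  by (auto simp: group_E_simps add_self)

lemma order_group_E: "order (group_E F) = (2 ^ d) ^ 2"
  using order_F by (simp add: order_def group_E_simps card_cartesian_product power2_eq_square)

text \<open>The lines through the origin are indexed by their slope, with \<open>None\<close> for the vertical line; the
  coordinate swap inverts the slope.\<close>

definition slopes :: "'f option set" where
  "slopes = insert None (Some ` carrier F)"

fun line :: "'f option \<Rightarrow> ('f \<times> 'f) set" where
  "line None = {\<zero>} \<times> carrier F"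
| "line (Some m) = (\<lambda>x. (x, m \<otimes> x)) ` carrier F"

fun swap_slope :: "'f option \<Rightarrow> 'f option" where
  "swap_slope None = Some \<zero>"
| "swap_slope (Some m) = (if m = \<zero> then None else Some (inv m))"

lemma finite_slopes: "finite slopes" and card_slopes: "card slopes = 2 ^ d + 1"
  using finite_F order_F by (simp_all add: slopes_def card_image order_def)

lemma inv_nonzero:
  assumes "m \<in> carrier F" "m \<noteq> \<zero>"
  shows "inv m \<in> carrier F" "inv m \<noteq> \<zero>" "inv m \<otimes> m = \<one>" "m \<otimes> inv m = \<one>" "inv (inv m) = m"
proof -
  have m: "m \<in> Units F"
    using assms by (simp add: field_Units)
  then show "inv m \<in> carrier F" "inv m \<otimes> m = \<one>" "m \<otimes> inv m = \<one>" "inv (inv m) = m"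
    by simp_all
  then show "inv m \<noteq> \<zero>"
    using assms by auto
qed

lemma swap_slope_involution:
  assumes "p \<in> slopes"
  shows "swap_slope p \<in> slopes \<and> swap_slope (swap_slope p) = p"
proof (cases p)
  case (Some m)
  then show ?thesis
    using assms inv_nonzero[of m] by (cases "m = \<zero>") (auto simp: slopes_def)
qed (simp add: slopes_def)

text \<open>A finite nonzero slope that equals its inverse squares to \<open>1\<close>, so the diagonal is the only line
  that the swap preserves.\<close>

lemma swap_slope_fixed: "{p \<in> slopes. swap_slope p = p} = {Some \<one>}"
proof -
  have "m = \<one>" if "m \<in> carrier F" "m \<noteq> \<zero>" "inv m = m" for m
    using square_eq_one[OF that(1)] inv_nonzero(4)[OF that(1,2)] that(3) by simp
  then show ?thesis
    by (auto simp: slopes_def split: if_splits)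
qed

lemma line_swap:
  assumes "p \<in> slopes" "(a, b) \<in> line p"
  shows "(b, a) \<in> line (swap_slope p)"
proof (cases p)
  case None
  then show ?thesis
    using assms by auto
next
  case (Some m)
  then have m: "m \<in> carrier F" and ab: "a \<in> carrier F" "b = m \<otimes> a"
    using assms by (auto simp: slopes_def)
  show ?thesis
  proof (cases "m = \<zero>")
    case True
    then show ?thesis
      using Some ab by simp
  next
    case False
    then have "a = inv m \<otimes> b"
      using inv_nonzero[OF m] ab m by (simp add: m_assoc[symmetric])
    then show ?thesis
      using Some False ab m by auto
  qed
qed

lemma subgroup_line:
  assumes "p \<in> slopes"
  shows "subgroup (line p) (group_E F) \<and> card (line p) = 2 ^ d"
proof
  interpret E: comm_group "group_E F"
    by (rule group_E_comm_group)
  have sub: "line p \<subseteq> carrier (group_E F)"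
    using assms by (auto simp: slopes_def group_E_simps)
  have inv_self: "inv\<^bsub>group_E F\<^esub> b = b" if "b \<in> carrier (group_E F)" for b
    using that group_E_square by (intro E.inv_equality)
  show "subgroup (line p) (group_E F)"
  proof (rule E.subgroupI[OF sub])
    show "line p \<noteq> {}"
      by (cases p) auto
    show "inv\<^bsub>group_E F\<^esub> b \<in> line p" if "b \<in> line p" for b
      using inv_self that sub by (metis subsetD)
    show "b \<otimes>\<^bsub>group_E F\<^esub> c \<in> line p" if bc: "b \<in> line p" "c \<in> line p" for b c
    proof (cases p)
      case None
      then show ?thesis
        using bc by (auto simp: group_E_simps)
    next
      case (Some m)
      then obtain x z where xz: "x \<in> carrier F" "z \<in> carrier F" "b = (x, m \<otimes> x)" "c = (z, m \<otimes> z)" "m \<in> carrier F"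
        using bc assms by (auto simp: slopes_def)
      then have "b \<otimes>\<^bsub>group_E F\<^esub> c = (x \<oplus> z, m \<otimes> (x \<oplus> z))"
        by (simp add: group_E_simps r_distr)
      then show ?thesis
        using Some xz by simp
    qed
  qed
  show "card (line p) = 2 ^ d"
    using order_F by (cases p) (simp_all add: card_image inj_on_def order_def card_cartesian_product)
qed

lemma ex1_line:
  assumes b: "b \<in> carrier (group_E F)" "b \<noteq> \<one>\<^bsub>group_E F\<^esub>"
  shows "\<exists>!p. p \<in> slopes \<and> b \<in> line p"
proof -
  obtain a c where ac: "b = (a, c)" "a \<in> carrier F" "c \<in> carrier F" "a = \<zero> \<Longrightarrow> c \<noteq> \<zero>"
    using b by (auto simp: group_E_simps)
  show ?thesis
  proof (cases "a = \<zero>")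
    case True
    have "p = None" if "p \<in> slopes" "b \<in> line p" for p
      using that ac True by (cases p) (auto simp: slopes_def)
    moreover have "None \<in> slopes \<and> b \<in> line None"
      using ac True by (simp add: slopes_def)
    ultimately show ?thesis
      by blast
  next
    case False
    note inv_a = inv_nonzero[OF ac(2) False]
    have c: "c = c \<otimes> inv a \<otimes> a"
      using inv_a ac by (simp add: m_assoc)
    have "p = Some (c \<otimes> inv a)" if p: "p \<in> slopes" "b \<in> line p" for p
    proof (cases p)
      case None
      then show ?thesis
        using p ac False by simp
    next
      case (Some m)
      then have "m \<in> carrier F" "c = m \<otimes> a"
        using p ac by (auto simp: slopes_def)
      then show ?thesis
        using Some inv_a ac by (simp add: m_assoc)
    qed
    moreover have "Some (c \<otimes> inv a) \<in> slopes \<and> b \<in> line (Some (c \<otimes> inv a))"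
      using ac inv_a c by (auto simp: slopes_def)
    ultimately show ?thesis
      by blast
  qed
qed

end

section \<open>A difference set invariant under the automorphism\<close>

lemma aut_psi_apply:
  assumes "((a, b), k) \<in> carrier (group_G' F K)"
  shows "aut_psi F K u ((a, b), k) = ((b, a), inv\<^bsub>K\<^esub> u \<otimes>\<^bsub>K\<^esub> k \<otimes>\<^bsub>K\<^esub> u)"
  using assms by (simp add: aut_psi_def)

text \<open>For \<open>d \<ge> 2\<close> the line belonging to \<open>u k u\<close> must be the swap of the line belonging to \<open>k\<close>. The
  element without a line is \<open>u\<close>, so that conjugation by \<open>u\<close> and the swap both have one fixed point, \<open>1\<close>
  and the diagonal. For \<open>d = 1\<close> the set of elements with exactly one trivial component is invariant
  under every automorphism that acts componentwise.\<close>

lemma ex_invariant_difference_set: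
  fixes F :: "('f, 'm) ring_scheme" and K :: "('k, 'c) monoid_scheme"
  assumes "binary_field F d" and "dihedral K n y u" and n: "2 * n = 2 ^ d + 2" and q: "q = 2 ^ d"
  shows "\<exists>D. difference_set (group_G' F K) (q ^ 2 * (q + 2)) (q * (q + 1)) q D \<and>
             (\<forall>g\<in>D. aut_psi F K u g \<in> D)"
proof -
  interpret F: binary_field F d by fact
  interpret K: dihedral K n y u by fact
  interpret E: comm_group "group_E F"
    by (rule F.group_E_comm_group)
  define conj where "conj k = u \<otimes>\<^bsub>K\<^esub> k \<otimes>\<^bsub>K\<^esub> u" for k
  have conj_closed: "conj k \<in> carrier K" if "k \<in> carrier K" for k
    using that by (simp add: conj_def)
  have conj_conj: "conj (conj k) = k" if "k \<in> carrier K" for k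
    using that by (simp add: conj_def K.m_assoc)
  have psi: "aut_psi F K u ((a, b), k) = ((b, a), conj k)"
    if "a \<in> carrier F" "b \<in> carrier F" "k \<in> carrier K" for a b k
    using that by (simp add: aut_psi_apply group_G'_def F.group_E_simps conj_def)
  have order_K: "order K = q + 2"
    using K.order_K n q by simp
  show ?thesis
  proof (cases "d = 1")
    case True
    \<comment> \<open>Here \<open>q = 2\<close>, and both factors have order 4.\<close>
    let ?D = "(carrier (group_E F) - {\<one>\<^bsub>group_E F\<^esub>}) \<times> {\<one>\<^bsub>K\<^esub>} \<union> {\<one>\<^bsub>group_E F\<^esub>} \<times> (carrier K - {\<one>\<^bsub>K\<^esub>})"
    have "difference_set (group_E F \<times>\<times> K) 16 6 2 ?D"
      using True order_K q F.order_group_E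
      by (intro difference_set_of_crossing_factors E.is_group K.is_group) simp_all
    moreover have "q ^ 2 * (q + 2) = 16" "q * (q + 1) = 6" "q = 2"
      using True q by simp_all
    moreover have "conj \<one>\<^bsub>K\<^esub> = \<one>\<^bsub>K\<^esub>"
      by (simp add: conj_def)
    moreover have "conj k = \<one>\<^bsub>K\<^esub> \<longleftrightarrow> k = \<one>\<^bsub>K\<^esub>" if "k \<in> carrier K" for k
      using that conj_conj \<open>conj \<one>\<^bsub>K\<^esub> = \<one>\<^bsub>K\<^esub>\<close> by metis
    ultimately show ?thesis
      unfolding group_G'_def
      by (intro exI[of _ ?D]) (auto simp: F.group_E_simps psi conj_closed)
  next
    case False
    then have d: "d \<ge> 2"
      using F.d_pos by simp
    have n': "n = 2 ^ (d - 1) + 1"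
      using n d by (cases d) simp_all
    interpret K: odd_dihedral K n y u
      using n' d by unfold_locales simp_all
    have fixed_K: "{k \<in> carrier K - {u}. conj k = k} = {\<one>\<^bsub>K\<^esub>}"
      using K.centralizer_u K.u_ne_one by (auto simp: conj_def)
    have conj_u: "conj k \<noteq> u" if "k \<in> carrier K" "k \<noteq> u" for k
    proof
      assume "conj k = u"
      then have "k = conj u"
        using conj_conj that by metis
      then show False
        using that by (simp add: conj_def)
    qed
    have "\<exists>f. bij_betw f (carrier K - {u}) F.slopes \<and> (\<forall>k\<in>carrier K - {u}. f (conj k) = F.swap_slope (f k))"
    proof (rule equivariant_bij_of_involutions)
      show "card (carrier K - {u}) = card F.slopes"
        using order_K q by (simp add: F.card_slopes order_def K.finite_K)
      show "card {k \<in> carrier K - {u}. conj k = k} = card {p \<in> F.slopes. F.swap_slope p = p}"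
        unfolding fixed_K F.swap_slope_fixed by simp
    qed (use conj_closed conj_conj conj_u F.swap_slope_involution K.finite_K F.finite_slopes in auto)
    then obtain f where f: "bij_betw f (carrier K - {u}) F.slopes"
      and equivariant: "\<And>k. k \<in> carrier K - {u} \<Longrightarrow> f (conj k) = F.swap_slope (f k)"
      by blast
    have f_mem: "f k \<in> F.slopes" if "k \<in> carrier K - {u}" for k
      using f that by (rule bij_betw_apply)
    let ?D = "{(b, k). k \<in> carrier K - {u} \<and> b \<in> F.line (f k)}"
    have ds: "difference_set (group_E F \<times>\<times> K) (q ^ 2 * (q + 2)) (q * (q + 1)) q ?D"
    proof (rule difference_set_of_spread)
      show "group (group_E F)" "group K"
        by (rule E.is_group K.is_group)+
      show "order (group_E F) = q ^ 2" "order K = q + 2" "q > 0" "u \<in> carrier K"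
        using F.order_group_E order_K q by simp_all
      show "subgroup (F.line (f k)) (group_E F) \<and> card (F.line (f k)) = q" if "k \<in> carrier K - {u}" for k
        using F.subgroup_line[OF f_mem[OF that]] q by simp
      show "\<exists>!k. k \<in> carrier K - {u} \<and> b \<in> F.line (f k)"
        if b: "b \<in> carrier (group_E F)" "b \<noteq> \<one>\<^bsub>group_E F\<^esub>" for b
      proof -
        obtain p where p: "p \<in> F.slopes" "b \<in> F.line p" "\<And>p'. \<lbrakk>p' \<in> F.slopes; b \<in> F.line p'\<rbrakk> \<Longrightarrow> p' = p"
          using F.ex1_line[OF b] by blast
        have "p \<in> f ` (carrier K - {u})"
          unfolding bij_betw_imp_surj_on[OF f] by (rule p(1))
        then obtain k where k: "p = f k" "k \<in> carrier K - {u}"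
          by (rule imageE)
        show ?thesis
        proof (rule ex1I[of _ k])
          show "k' = k" if "k' \<in> carrier K - {u} \<and> b \<in> F.line (f k')" for k'
          proof -
            have "f k' = f k"
              using p(3)[OF f_mem] that k(1) by simp
            then show ?thesis
              using inj_onD[OF bij_betw_imp_inj_on[OF f]] that k(2) by simp
          qed
        qed (use k p(2) in simp)
      qed
    qed
    have invariant: "aut_psi F K u g \<in> ?D" if g: "g \<in> ?D" for g
    proof -
      obtain a b k where abk: "g = ((a, b), k)" "k \<in> carrier K - {u}" "(a, b) \<in> F.line (f k)"
        using g by auto
      then have "(a, b) \<in> carrier (group_E F)"
        using F.subgroup_line[OF f_mem[OF abk(2)]] by (blast intro: subgroup.mem_carrier)
      then have "aut_psi F K u g = ((b, a), conj k)"
        using abk psi by (simp add: F.group_E_simps)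
      moreover have "(b, a) \<in> F.line (f (conj k))"
        using F.line_swap[OF f_mem] abk equivariant by simp
      ultimately show ?thesis
        using abk conj_closed conj_u by simp
    qed
    show ?thesis
    proof (intro exI[of _ ?D] conjI ballI)
      show "difference_set (group_G' F K) (q ^ 2 * (q + 2)) (q * (q + 1)) q ?D"
        unfolding group_G'_def by (rule ds)
    qed (rule invariant)
  qed
qed

section \<open>The group as a twist of the direct product\<close>

locale construction = F: binary_field F d + K: dihedral K n y u
  for F :: "('f, 'm) ring_scheme" and d :: nat and K :: "('k, 'c) monoid_scheme" and n :: nat and y u :: 'k +
  fixes e :: "nat \<Rightarrow> 'f \<times> 'f"
  assumes n_eq: "2 * n = 2 ^ d + 2"
    and admissible: "admissible_generators d F e"
begin

abbreviation E :: "('f \<times> 'f) monoid" where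
  "E \<equiv> group_E F"

text \<open>The index 2 subgroup of \<open>E\<close> whose elements occur with first component \<open>1\<close> in the group under
  study; its complement occurs with \<open>\<psi>\<close>.\<close>

definition H :: "('f \<times> 'f) set" where
  "H = generate E ({e 1 \<otimes>\<^bsub>E\<^esub> e 2} \<union> e ` {3..2 * d})"

sublocale E: comm_group E
  by (rule F.group_E_comm_group)

lemma e_closed: "i \<in> {1..2 * d} \<Longrightarrow> e i \<in> carrier E"
  and generate_e: "generate E (e ` {1..2 * d}) = carrier E"
  and e_1: "e 1 = (\<one>\<^bsub>F\<^esub>, \<zero>\<^bsub>F\<^esub>)" and e_2: "e 2 = (\<zero>\<^bsub>F\<^esub>, \<one>\<^bsub>F\<^esub>)"
  and swap_H: "prod.swap ` H = H"
  using admissible unfolding admissible_generators_def H_def Let_def by blast+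

lemma e_1_closed: "e 1 \<in> carrier E" and e_2_closed: "e 2 \<in> carrier E"
  using F.d_pos by (auto intro: e_closed)

lemma H_generators: "{e 1 \<otimes>\<^bsub>E\<^esub> e 2} \<union> e ` {3..2 * d} \<subseteq> carrier E"
  using e_1_closed e_2_closed e_closed by auto

lemma subgroup_H: "subgroup H E"
  unfolding H_def using H_generators by (rule E.generate_is_subgroup)

text \<open>The generators of \<open>H\<close> together with \<open>e\<^sub>1\<close> generate \<open>E\<close>, because \<open>e\<^sub>2 = e\<^sub>1 + (e\<^sub>1 + e\<^sub>2)\<close>.\<close>

lemma carrier_E_cosets: "carrier E \<subseteq> H \<union> (\<lambda>h. e 1 \<otimes>\<^bsub>E\<^esub> h) ` H"
proof -
  let ?A = "{e 1 \<otimes>\<^bsub>E\<^esub> e 2} \<union> e ` {3..2 * d}"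
  have A: "insert (e 1) ?A \<subseteq> carrier E"
    using H_generators e_1_closed by blast
  have e2: "e 2 = e 1 \<otimes>\<^bsub>E\<^esub> (e 1 \<otimes>\<^bsub>E\<^esub> e 2)"
    using e_1_closed e_2_closed by (simp add: E.m_assoc[symmetric] F.group_E_square)
  have "e 1 \<otimes>\<^bsub>E\<^esub> (e 1 \<otimes>\<^bsub>E\<^esub> e 2) \<in> generate E (insert (e 1) ?A)"
    by (intro generate.eng generate.incl) simp_all
  then have e2_mem: "e 2 \<in> generate E (insert (e 1) ?A)"
    using e2 by simp
  have "e i \<in> generate E (insert (e 1) ?A)" if i: "i \<in> {1..2 * d}" for i
  proof -
    have "i = 1 \<or> i = 2 \<or> i \<in> {3..2 * d}"
      using i by auto
    then consider "i = 1" | "i = 2" | "i \<in> {3..2 * d}"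
      by blast
    then show ?thesis
    proof cases
      case 2
      then show ?thesis
        using e2_mem by (simp only:)
    qed (auto intro: generate.incl)
  qed
  then have "e ` {1..2 * d} \<subseteq> generate E (insert (e 1) ?A)"
    by blast
  then have "generate E (e ` {1..2 * d}) \<subseteq> generate E (insert (e 1) ?A)"
    by (intro E.generate_subgroup_incl E.generate_is_subgroup A)
  also have "\<dots> \<subseteq> H \<union> (\<lambda>h. e 1 \<otimes>\<^bsub>E\<^esub> h) ` H"
    unfolding H_def using F.group_E_square H_generators e_1_closed by (rule E.generate_insert_subset)
  finally show ?thesis
    by (simp only: generate_e)
qed

text \<open>If \<open>e\<^sub>1\<close> were in \<open>H\<close>, then \<open>E\<close>, of order \<open>2\<^bsup>2d\<^esup>\<close>, would be generated by the \<open>2 d - 1\<close> generators of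
  \<open>H\<close>.\<close>

lemma e_1_notin_H: "e 1 \<notin> H"
proof
  assume "e 1 \<in> H"
  then have "(\<lambda>h. e 1 \<otimes>\<^bsub>E\<^esub> h) ` H \<subseteq> H"
    using subgroup.m_closed[OF subgroup_H] by blast
  then have "carrier E = H"
    using carrier_E_cosets subgroup.subset[OF subgroup_H] by blast
  then have "(2 ^ d) ^ 2 = card H"
    using F.order_group_E by (simp add: order_def)
  also have "\<dots> \<le> 2 ^ card ({e 1 \<otimes>\<^bsub>E\<^esub> e 2} \<union> e ` {3..2 * d})"
    unfolding H_def using E.card_generate_le[OF F.group_E_square _ H_generators] by simp
  also have "card ({e 1 \<otimes>\<^bsub>E\<^esub> e 2} \<union> e ` {3..2 * d}) \<le> 2 * d - 1"
  proof -
    have "card ({e 1 \<otimes>\<^bsub>E\<^esub> e 2} \<union> e ` {3..2 * d}) \<le> 1 + card (e ` {3..2 * d})"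
      using card_Un_le[of "{e 1 \<otimes>\<^bsub>E\<^esub> e 2}" "e ` {3..2 * d}"] by simp
    also have "\<dots> \<le> 1 + card {3..2 * d}"
      using card_image_le[of "{3..2 * d}" e] by simp
    finally show ?thesis
      using F.d_pos by simp
  qed
  then have "2 ^ card ({e 1 \<otimes>\<^bsub>E\<^esub> e 2} \<union> e ` {3..2 * d}) \<le> (2::nat) ^ (2 * d - 1)"
    by (intro power_increasing) simp_all
  also have "\<dots> < 2 ^ (2 * d)"
    using F.d_pos by (intro power_strict_increasing) simp_all
  finally show False
    by (simp add: power_mult[symmetric] mult.commute)
qed

abbreviation B :: "(('f \<times> 'f) \<times> 'k) monoid" where
  "B \<equiv> group_G' F K"

lemma B_simps:
  "carrier B = (carrier F \<times> carrier F) \<times> carrier K"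
  "(b, k) \<otimes>\<^bsub>B\<^esub> (b', k') = (b \<otimes>\<^bsub>E\<^esub> b', k \<otimes>\<^bsub>K\<^esub> k')"
  "\<one>\<^bsub>B\<^esub> = (\<one>\<^bsub>E\<^esub>, \<one>\<^bsub>K\<^esub>)"
  by (simp_all add: group_G'_def F.group_E_simps)

lemma group_B: "group B"
  unfolding group_G'_def by (intro DirProd_group E.is_group K.is_group)

lemma psi_apply:
  "\<lbrakk>a \<in> carrier F; b \<in> carrier F; k \<in> carrier K\<rbrakk>
    \<Longrightarrow> aut_psi F K u ((a, b), k) = ((b, a), u \<otimes>\<^bsub>K\<^esub> k \<otimes>\<^bsub>K\<^esub> u)"
  by (simp add: aut_psi_apply B_simps)

lemma psi_auto: "aut_psi F K u \<in> auto B"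
proof -
  have closed: "aut_psi F K u \<in> carrier B \<rightarrow> carrier B"
    by (auto simp: B_simps psi_apply)
  have "aut_psi F K u \<in> hom B B"
  proof (rule homI)
    fix x z
    assume "x \<in> carrier B" "z \<in> carrier B"
    then show "aut_psi F K u (x \<otimes>\<^bsub>B\<^esub> z) = aut_psi F K u x \<otimes>\<^bsub>B\<^esub> aut_psi F K u z"
      by (auto simp: B_simps psi_apply F.group_E_simps K.m_assoc)
  qed (use closed in auto)
  moreover have "bij_betw (aut_psi F K u) (carrier B) (carrier B)"
    by (rule bij_betw_byWitness[where f' = "aut_psi F K u"])
      (auto simp: B_simps psi_apply K.m_assoc)
  moreover have "aut_psi F K u \<in> extensional (carrier B)"
    by (simp add: aut_psi_def)
  ultimately show ?thesis
    by (simp add: auto_def Bij_def)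
qed

text \<open>The invariance of \<open>H\<close> under the coordinate swap is part of the admissibility of the generators.\<close>

sublocale twisting B "aut_psi F K u" "H \<times> carrier K"
proof (intro twisting.intro twisting_axioms.intro group_B)
  show "aut_psi F K u \<in> auto B"
    by (rule psi_auto)
  show "aut_psi F K u (aut_psi F K u g) = g" if "g \<in> carrier B" for g
    using that by (auto simp: B_simps psi_apply K.m_assoc)
  show "subgroup (H \<times> carrier K) B"
    unfolding group_G'_def
    by (intro DirProd_subgroups E.is_group K.is_group subgroup_H K.subgroup_self)
  show "aut_psi F K u g \<in> H \<times> carrier K" if g: "g \<in> H \<times> carrier K" for g
  proof -
    obtain a b k where abk: "g = ((a, b), k)" "(a, b) \<in> H" "k \<in> carrier K"
      using g by auto
    have "(b, a) \<in> prod.swap ` H"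
      using imageI[OF abk(2), of prod.swap] by simp
    then have "(b, a) \<in> H"
      unfolding swap_H .
    moreover have "(a, b) \<in> carrier E"
      using abk(2) by (rule subgroup.mem_carrier[OF subgroup_H])
    ultimately show ?thesis
      using abk by (simp add: F.group_E_simps psi_apply)
  qed
  show "g \<otimes>\<^bsub>B\<^esub> h \<in> H \<times> carrier K"
    if gh: "g \<in> carrier B - H \<times> carrier K" "h \<in> carrier B - H \<times> carrier K" for g h
  proof -
    obtain b k b' k' where bk: "g = (b, k)" "h = (b', k')"
      by (metis surj_pair)
    have mem: "b \<in> carrier E" "b \<notin> H" "k \<in> carrier K" "b' \<in> carrier E" "b' \<notin> H" "k' \<in> carrier K"
      using gh unfolding bk by (auto simp: B_simps F.group_E_simps)
    obtain h1 where h1: "h1 \<in> H" "b = e 1 \<otimes>\<^bsub>E\<^esub> h1"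
      using carrier_E_cosets mem by blast
    obtain h2 where h2: "h2 \<in> H" "b' = e 1 \<otimes>\<^bsub>E\<^esub> h2"
      using carrier_E_cosets mem by blast
    have c: "h1 \<in> carrier E" "h2 \<in> carrier E"
      using h1 h2 subgroup.mem_carrier[OF subgroup_H] by blast+
    have "b \<otimes>\<^bsub>E\<^esub> b' = (e 1 \<otimes>\<^bsub>E\<^esub> e 1) \<otimes>\<^bsub>E\<^esub> (h1 \<otimes>\<^bsub>E\<^esub> h2)"
      using h1 h2 c e_1_closed by (simp add: E.m_ac)
    also have "\<dots> = h1 \<otimes>\<^bsub>E\<^esub> h2"
      using F.group_E_square[OF e_1_closed] c by simp
    finally have "b \<otimes>\<^bsub>E\<^esub> b' \<in> H"
      using h1(1) h2(1) subgroup.m_closed[OF subgroup_H] by simp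
    then show ?thesis
      using mem by (simp add: bk B_simps)
  qed
qed

text \<open>The generators are the twist of \<open>(e\<^sub>1, 1)\<close> and the embedded generators of \<open>H \<times> K\<close>.\<close>

lemma calG'_eq_twisted: "group_calG' d F K y u e = twisted"
proof -
  let ?Y = "(\<lambda>x. (x, \<one>\<^bsub>K\<^esub>)) ` ({e 1 \<otimes>\<^bsub>E\<^esub> e 2} \<union> e ` {3..2 * d}) \<union> (\<lambda>k. (\<one>\<^bsub>E\<^esub>, k)) ` {y, u}"
  have "generate B ?Y = H \<times> carrier K"
    unfolding group_G'_def H_def K.generate_yu[symmetric]
    using H_generators by (intro generate_DirProd E.is_group K.is_group) simp_all
  then have gen: "generate ambient (insert (twist (e 1, \<one>\<^bsub>K\<^esub>)) ((\<lambda>x. (\<one>\<^bsub>AutoGroup B\<^esub>, x)) ` ?Y))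
      = twist ` carrier B"
  proof (rule generate_twist)
    show "(e 1, \<one>\<^bsub>K\<^esub>) \<in> carrier B" "(e 1, \<one>\<^bsub>K\<^esub>) \<notin> H \<times> carrier K"
      using e_1_closed e_1_notin_H by (simp_all add: B_simps F.group_E_simps)
  qed
  have "{(\<one>\<^bsub>AutoGroup B\<^esub>, (e i, \<one>\<^bsub>K\<^esub>)) | i. 3 \<le> i \<and> i \<le> 2 * d}
      = (\<lambda>x. (\<one>\<^bsub>AutoGroup B\<^esub>, x)) ` (\<lambda>x. (x, \<one>\<^bsub>K\<^esub>)) ` e ` {3..2 * d}"
    by auto
  moreover have "twist (e 1, \<one>\<^bsub>K\<^esub>) = (aut_psi F K u, (e 1, \<one>\<^bsub>K\<^esub>))"
    using e_1_notin_H by (simp add: twist_def twist_aut_def)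
  ultimately have "{(aut_psi F K u, (e 1, \<one>\<^bsub>K\<^esub>)), (\<one>\<^bsub>AutoGroup B\<^esub>, (\<one>\<^bsub>E\<^esub>, y)), (\<one>\<^bsub>AutoGroup B\<^esub>, (\<one>\<^bsub>E\<^esub>, u)),
        (\<one>\<^bsub>AutoGroup B\<^esub>, (e 1 \<otimes>\<^bsub>E\<^esub> e 2, \<one>\<^bsub>K\<^esub>))} \<union> {(\<one>\<^bsub>AutoGroup B\<^esub>, (e i, \<one>\<^bsub>K\<^esub>)) | i. 3 \<le> i \<and> i \<le> 2 * d}
      = insert (twist (e 1, \<one>\<^bsub>K\<^esub>)) ((\<lambda>x. (\<one>\<^bsub>AutoGroup B\<^esub>, x)) ` ?Y)"
    by (simp add: image_Un insert_commute Un_commute)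
  then show ?thesis
    using gen by (simp only: group_calG'_def Let_def psi_ext_def)
qed

section \<open>Normal 2-subgroups\<close>

sublocale T: group twisted
  by (rule twisted_group)

text \<open>The homomorphism \<open>(\<psi>\<^sup>i, b, c) \<mapsto> u\<^sup>i c\<close>: in the semidirect product \<open>\<psi>\<close> acts on \<open>K\<close> as \<open>u\<close> does, and
  \<open>i\<close> is odd exactly when \<open>b \<notin> H\<close>.\<close>

definition proj :: "((('f \<times> 'f) \<times> 'k \<Rightarrow> ('f \<times> 'f) \<times> 'k) \<times> (('f \<times> 'f) \<times> 'k)) \<Rightarrow> 'k" where
  "proj t = (let (b, k) = snd t in if b \<in> H then k else u \<otimes>\<^bsub>K\<^esub> k)"

lemma proj_twist: "proj (twist (b, k)) = (if b \<in> H then k else u \<otimes>\<^bsub>K\<^esub> k)"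
  by (simp add: proj_def twist_def)

lemma in_carrier_B: "(b, k) \<in> carrier B \<longleftrightarrow> b \<in> carrier E \<and> k \<in> carrier K"
  by (auto simp: B_simps F.group_E_simps)

lemma proj_hom: "proj \<in> hom twisted K"
proof (rule homI)
  show "proj t \<in> carrier K" if t: "t \<in> carrier twisted" for t
  proof -
    obtain b k where "t = twist (b, k)" "(b, k) \<in> carrier B"
      using t by auto
    then show ?thesis
      by (simp add: proj_twist in_carrier_B)
  qed
next
  fix s t
  assume "s \<in> carrier twisted" "t \<in> carrier twisted"
  then obtain b k b' k' where bk: "s = twist (b, k)" "(b, k) \<in> carrier B"
    and bk': "t = twist (b', k')" "(b', k') \<in> carrier B"
    by auto
  obtain a c where ac: "b = (a, c)" "a \<in> carrier F" "c \<in> carrier F"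
    using bk(2) by (auto simp: B_simps)
  have k: "k \<in> carrier K" "k' \<in> carrier K"
    using bk bk' by (simp_all add: in_carrier_B)
  define z where "z = fst (twist_aut (b', k') (b, k)) \<otimes>\<^bsub>E\<^esub> b'"
  define w where "w = (if b' \<in> H then k else u \<otimes>\<^bsub>K\<^esub> k \<otimes>\<^bsub>K\<^esub> u) \<otimes>\<^bsub>K\<^esub> k'"
  have w: "w \<in> carrier K"
    using k by (simp add: w_def)
  have prod: "twist_aut (b', k') (b, k) \<otimes>\<^bsub>B\<^esub> (b', k') = (z, w)"
    using bk(2) k ac by (simp add: z_def w_def twist_aut_apply psi_apply B_simps)
  have "twist_aut (b', k') (b, k) \<otimes>\<^bsub>B\<^esub> (b', k') \<in> H \<times> carrier K
      \<longleftrightarrow> ((b, k) \<in> H \<times> carrier K \<longleftrightarrow> (b', k') \<in> H \<times> carrier K)"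
    using bk(2) bk'(2) by (simp only: mult_in_B0_iff twist_aut_closed twist_aut_in_B0_iff)
  then have "z \<in> H \<longleftrightarrow> (b \<in> H \<longleftrightarrow> b' \<in> H)"
    unfolding prod using w k by simp
  moreover have "s \<otimes>\<^bsub>twisted\<^esub> t = twist (z, w)"
    using twist_mult[OF bk(2) bk'(2)] prod by (simp add: bk(1) bk'(1))
  ultimately show "proj (s \<otimes>\<^bsub>twisted\<^esub> t) = proj s \<otimes>\<^bsub>K\<^esub> proj t"
    using k by (auto simp: bk(1) bk'(1) proj_twist w_def K.m_assoc)
qed

sublocale proj: group_hom twisted K proj
  by (unfold_locales) (rule proj_hom)

lemma kernel_proj:
  "{t \<in> carrier twisted. proj t = \<one>\<^bsub>K\<^esub>} = (\<lambda>b. twist (b, if b \<in> H then \<one>\<^bsub>K\<^esub> else u)) ` carrier E"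
proof -
  let ?f = "\<lambda>b. twist (b, if b \<in> H then \<one>\<^bsub>K\<^esub> else u)"
  have "t \<in> ?f ` carrier E" if t: "t \<in> carrier twisted" "proj t = \<one>\<^bsub>K\<^esub>" for t
  proof -
    obtain b k where bk: "t = twist (b, k)" "b \<in> carrier E" "k \<in> carrier K"
      using t(1) in_carrier_B by auto
    have "k = u" if "u \<otimes>\<^bsub>K\<^esub> k = \<one>\<^bsub>K\<^esub>"
    proof -
      have "k = u \<otimes>\<^bsub>K\<^esub> (u \<otimes>\<^bsub>K\<^esub> k)"
        using bk(3) by simp
      also have "\<dots> = u"
        unfolding that by simp
      finally show ?thesis .
    qed
    then have "k = (if b \<in> H then \<one>\<^bsub>K\<^esub> else u)"
      using t(2) by (simp add: bk(1) proj_twist split: if_splits)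
    then have "t = ?f b"
      using bk(1) by simp
    then show ?thesis
      using bk(2) by (rule image_eqI)
  qed
  moreover have "?f b \<in> carrier twisted" "proj (?f b) = \<one>\<^bsub>K\<^esub>" if "b \<in> carrier E" for b
    using that by (simp_all add: in_carrier_B proj_twist)
  ultimately show ?thesis
    by blast
qed

lemma card_kernel_proj: "card {t \<in> carrier twisted. proj t = \<one>\<^bsub>K\<^esub>} = (2 ^ d) ^ 2"
proof -
  have "inj_on (\<lambda>b. twist (b, if b \<in> H then \<one>\<^bsub>K\<^esub> else u)) (carrier E)"
    by (auto simp: inj_on_def twist_def)
  then show ?thesis
    unfolding kernel_proj using F.order_group_E by (simp add: card_image order_def)
qed

lemma finite_kernel_proj: "finite {t \<in> carrier twisted. proj t = \<one>\<^bsub>K\<^esub>}"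
  unfolding kernel_proj using F.finite_F by (simp add: F.group_E_simps)

text \<open>The element \<open>(\<psi>, e\<^sub>1, u)\<close> has square \<open>(1, e\<^sub>1 + e\<^sub>2, 1)\<close>, so the kernel of the projection is not of
  exponent 2.\<close>

lemma twist_e_1_u:
  assumes "t = twist (e 1, u)"
  shows "t \<in> carrier twisted" "proj t = \<one>\<^bsub>K\<^esub>" "t \<otimes>\<^bsub>twisted\<^esub> t \<noteq> \<one>\<^bsub>twisted\<^esub>"
proof -
  have c: "(e 1, u) \<in> carrier B"
    using e_1_closed by (simp add: in_carrier_B)
  then show "t \<in> carrier twisted"
    using assms by simp
  show "proj t = \<one>\<^bsub>K\<^esub>"
    using assms e_1_notin_H by (simp add: proj_twist)
  have "t \<otimes>\<^bsub>twisted\<^esub> t = twist (twist_aut (e 1, u) (e 1, u) \<otimes>\<^bsub>B\<^esub> (e 1, u))"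
    using assms twist_mult[OF c c] by simp
  also have "twist_aut (e 1, u) (e 1, u) \<otimes>\<^bsub>B\<^esub> (e 1, u) = ((\<one>\<^bsub>F\<^esub>, \<one>\<^bsub>F\<^esub>), \<one>\<^bsub>K\<^esub>)"
  proof -
    have "twist_aut (e 1, u) (e 1, u) = aut_psi F K u (e 1, u)"
      using twist_aut_apply[OF c] e_1_notin_H by simp
    then show ?thesis
      by (simp only: e_1) (simp add: psi_apply B_simps F.group_E_simps)
  qed
  finally have "t \<otimes>\<^bsub>twisted\<^esub> t = twist ((\<one>\<^bsub>F\<^esub>, \<one>\<^bsub>F\<^esub>), \<one>\<^bsub>K\<^esub>)" .
  moreover have "\<one>\<^bsub>twisted\<^esub> = twist ((\<zero>\<^bsub>F\<^esub>, \<zero>\<^bsub>F\<^esub>), \<one>\<^bsub>K\<^esub>)"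
    by (simp add: twist_one[symmetric] B_simps F.group_E_simps)
  ultimately show "t \<otimes>\<^bsub>twisted\<^esub> t \<noteq> \<one>\<^bsub>twisted\<^esub>"
    by (simp add: twist_def)
qed

end

locale nonabelian_construction = construction + odd_dihedral K n y u
begin

lemma twist_K:
  assumes "k \<in> carrier K"
  shows "twist (\<one>\<^bsub>E\<^esub>, k) \<in> carrier twisted" "proj (twist (\<one>\<^bsub>E\<^esub>, k)) = k"
  using assms subgroup.one_closed[OF subgroup_H] by (simp_all add: in_carrier_B proj_twist)

text \<open>The image of a normal 2-subgroup in the odd dihedral quotient is trivial.\<close>

lemma normal_2_subgroup_in_kernel:
  assumes N: "N \<lhd> twisted" and card: "card N = 2 ^ a"
  shows "N \<subseteq> {t \<in> carrier twisted. proj t = \<one>\<^bsub>K\<^esub>}"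
proof
  fix t
  assume t: "t \<in> N"
  interpret N: normal N twisted
    by (rule N)
  have tc: "t \<in> carrier twisted"
    using t by (rule N.mem_carrier)
  have pow: "proj s [^]\<^bsub>K\<^esub> (2 ^ a :: nat) = \<one>\<^bsub>K\<^esub>" if "s \<in> N" for s
  proof -
    have "s [^]\<^bsub>twisted\<^esub> card N = \<one>\<^bsub>twisted\<^esub>"
      using that by (intro T.pow_card_subgroup N.subgroup_axioms)
    then have "proj s [^]\<^bsub>K\<^esub> card N = proj \<one>\<^bsub>twisted\<^esub>"
      by (simp only: proj.hom_nat_pow[OF N.mem_carrier[OF that], symmetric])
    also have "\<dots> = \<one>\<^bsub>K\<^esub>"
      by (rule proj.hom_one)
    finally show ?thesis
      by (simp only: card)
  qed
  \<comment> \<open>The commutator with a preimage of \<open>y\<close> stays in the normal subgroup.\<close>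
  define g where "g = twist (\<one>\<^bsub>E\<^esub>, y)"
  have g: "g \<in> carrier twisted" "proj g = y"
    unfolding g_def by (rule twist_K, rule K.y_closed)+
  have "g \<otimes>\<^bsub>twisted\<^esub> t \<otimes>\<^bsub>twisted\<^esub> inv\<^bsub>twisted\<^esub> g \<otimes>\<^bsub>twisted\<^esub> inv\<^bsub>twisted\<^esub> t \<in> N"
    by (rule N.m_closed[OF N.inv_op_closed2[OF g(1) t] N.m_inv_closed[OF t]])
  moreover have "proj (g \<otimes>\<^bsub>twisted\<^esub> t \<otimes>\<^bsub>twisted\<^esub> inv\<^bsub>twisted\<^esub> g \<otimes>\<^bsub>twisted\<^esub> inv\<^bsub>twisted\<^esub> t)
      = y \<otimes>\<^bsub>K\<^esub> proj t \<otimes>\<^bsub>K\<^esub> inv\<^bsub>K\<^esub> y \<otimes>\<^bsub>K\<^esub> inv\<^bsub>K\<^esub> proj t"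
    using proj.hom_mult proj.hom_inv g tc T.m_closed T.inv_closed by metis
  ultimately have "(y \<otimes>\<^bsub>K\<^esub> proj t \<otimes>\<^bsub>K\<^esub> inv\<^bsub>K\<^esub> y \<otimes>\<^bsub>K\<^esub> inv\<^bsub>K\<^esub> proj t) [^]\<^bsub>K\<^esub> (2 ^ a :: nat) = \<one>\<^bsub>K\<^esub>"
    using pow by metis
  then have "proj t = \<one>\<^bsub>K\<^esub>"
    by (rule two_core_trivial[OF proj.hom_closed[OF tc] pow[OF t]])
  then show "t \<in> {t \<in> carrier twisted. proj t = \<one>\<^bsub>K\<^esub>}"
    using tc by simp
qed

lemma twisted_not_commutative: "\<not> comm_group twisted"
proof
  assume comm: "comm_group twisted"
  let ?s = "twist (\<one>\<^bsub>E\<^esub>, y)" and ?t = "twist (\<one>\<^bsub>E\<^esub>, u)"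
  have st: "?s \<in> carrier twisted" "?t \<in> carrier twisted"
    by (rule twist_K, simp)+
  have "?t \<otimes>\<^bsub>twisted\<^esub> ?s = ?s \<otimes>\<^bsub>twisted\<^esub> ?t"
    using comm_monoid.m_comm[OF comm_group.axioms(1)[OF comm] st(2) st(1)] .
  then have "proj ?t \<otimes>\<^bsub>K\<^esub> proj ?s = proj ?s \<otimes>\<^bsub>K\<^esub> proj ?t"
    using proj.hom_mult[OF st] proj.hom_mult[OF st(2) st(1)] by simp
  then have "u \<otimes>\<^bsub>K\<^esub> y = y \<otimes>\<^bsub>K\<^esub> u"
    by (simp only: twist_K K.y_closed K.u_closed)
  then have "inv\<^bsub>K\<^esub> y = y"
    by (simp add: K.u_y)
  then have "y \<otimes>\<^bsub>K\<^esub> y = \<one>\<^bsub>K\<^esub>"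
    using K.r_inv[of y] by simp
  then show False
    using rotation_squared_trivial[of 1] y_ne_one by simp
qed

text \<open>The order is \<open>2\<^bsup>2d+1\<^esup> n\<close>, so a Sylow 2-subgroup is too large for the kernel of the projection.\<close>

lemma no_normal_sylow_2_subgroup: "\<not> (\<exists>P. sylow_subgroup 2 P twisted \<and> P \<lhd> twisted)"
proof
  assume "\<exists>P. sylow_subgroup 2 P twisted \<and> P \<lhd> twisted"
  then obtain P where card: "card P = 2 ^ multiplicity 2 (order twisted)" and normal: "P \<lhd> twisted"
    by (auto simp: sylow_subgroup_def)
  have "order B = (2 ^ d) ^ 2 * (2 * n)"
    using F.order_group_E K.order_K by (simp add: order_def group_G'_def card_cartesian_product)
  then have "order twisted = (2 ^ d) ^ 2 * (2 * n)"
    by (simp only: order_twisted)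
  also have "\<dots> = 2 ^ (2 * d + 1) * n"
    by (simp add: power_mult[symmetric] mult.commute)
  finally have ord: "order twisted = 2 ^ (2 * d + 1) * n" .
  have "2 * d + 1 \<le> multiplicity 2 (order twisted)"
    using K.n_pos by (intro multiplicity_geI) (simp_all add: ord)
  then have "(2::nat) ^ (2 * d + 1) \<le> card P"
    unfolding card by (intro power_increasing) simp_all
  moreover have "card P \<le> (2 ^ d) ^ 2"
    using card_mono[OF finite_kernel_proj normal_2_subgroup_in_kernel[OF normal card]] card_kernel_proj
    by simp
  moreover have "(2::nat) ^ (2 * d + 1) = 2 * (2 ^ d) ^ 2" "(0::nat) < (2 ^ d) ^ 2"
    by (simp_all add: power_mult[symmetric] mult.commute)
  ultimately show False
    by linarith
qed

text \<open>By its order the subgroup is the whole kernel of the projection, and its exponent can only be 2.\<close>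

lemma no_normal_elementary_abelian_subgroup:
  "\<not> (\<exists>N. N \<lhd> twisted \<and> elementary_abelian (twisted\<lparr>carrier := N\<rparr>) \<and> card N = (2 ^ d) ^ 2)"
proof
  assume "\<exists>N. N \<lhd> twisted \<and> elementary_abelian (twisted\<lparr>carrier := N\<rparr>) \<and> card N = (2 ^ d) ^ 2"
  then obtain N where normal: "N \<lhd> twisted" and elem: "elementary_abelian (twisted\<lparr>carrier := N\<rparr>)"
    and card: "card N = (2 ^ d) ^ 2"
    by blast
  obtain p :: nat where p: "Factorial_Ring.prime p"
    and exponent: "\<forall>x \<in> carrier (twisted\<lparr>carrier := N\<rparr>). x [^]\<^bsub>twisted\<lparr>carrier := N\<rparr>\<^esub> p = \<one>\<^bsub>twisted\<lparr>carrier := N\<rparr>\<^esub>"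
    using elem unfolding elementary_abelian_def by blast
  have card': "card N = 2 ^ (d * 2)"
    using card by (simp add: power_mult)
  have "N = {t \<in> carrier twisted. proj t = \<one>\<^bsub>K\<^esub>}"
    using normal_2_subgroup_in_kernel[OF normal card'] card card_kernel_proj
    by (intro card_subset_eq[OF finite_kernel_proj]) simp_all
  then have N_eq: "t \<in> N \<longleftrightarrow> t \<in> carrier twisted \<and> proj t = \<one>\<^bsub>K\<^esub>" for t
    by blast
  define t where "t = twist (e 1, u)"
  note t' = twist_e_1_u[OF t_def]
  have "t \<in> N"
    unfolding N_eq using t'(1,2) by (rule conjI)
  note t = this t'(1,3)
  have tp: "t [^]\<^bsub>twisted\<^esub> p = \<one>\<^bsub>twisted\<^esub>"
  proof -
    have "t \<in> carrier (twisted\<lparr>carrier := N\<rparr>)"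
      using t(1) by simp
    with exponent have "t [^]\<^bsub>twisted\<lparr>carrier := N\<rparr>\<^esub> p = \<one>\<^bsub>twisted\<lparr>carrier := N\<rparr>\<^esub>"
      by (rule bspec)
    then have "t [^]\<^bsub>twisted\<^esub> p = \<one>\<^bsub>twisted\<lparr>carrier := N\<rparr>\<^esub>"
      by (simp only: T.nat_pow_consistent[of t p N, symmetric])
    then show ?thesis
      by simp
  qed
  have "p \<noteq> 2"
    using tp t(3) T.pow_two[OF t(2)] by metis
  then have "coprime p (2 ^ (d * 2))"
    using primes_coprime[OF p two_is_prime_nat] by simp
  moreover have "t [^]\<^bsub>twisted\<^esub> (2 ^ (d * 2) :: nat) = \<one>\<^bsub>twisted\<^esub>"
    using T.pow_card_subgroup[OF normal_imp_subgroup[OF normal] t(1)] card' by simp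
  ultimately have "t = \<one>\<^bsub>twisted\<^esub>"
    using T.eq_one_if_coprime_exponents[OF t(2) tp] by blast
  then show False
    using t(3) T.l_one[OF T.one_closed] by simp
qed

end

theorem theorem7p9:
  fixes d q :: nat
    and F :: "('f, 'm) ring_scheme"
    and K :: "('k, 'c) monoid_scheme"
    and y u :: 'k
    and e :: "nat \<Rightarrow> 'f \<times> 'f"
  assumes "d \<ge> 1" and "q = 2 ^ d"
    and "field F" and "order F = q"
    and "dihedral_presentation K ((q + 2) div 2) y u"
    and "admissible_generators d F e"
  shows "let G = group_calG' d F K y u e in
    group G \<and>
    mcfarland_parameters q 1 = (q ^ 2 * (q + 2), q * (q + 1), q) \<and>
    (\<exists>D. difference_set G (q ^ 2 * (q + 2)) (q * (q + 1)) q D) \<and>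
    (d \<ge> 2 \<longrightarrow>
      \<not> comm_group G \<and>
      \<not> (\<exists>P. sylow_subgroup 2 P G \<and> P \<lhd> G) \<and>
      \<not> (\<exists>N. N \<lhd> G \<and> elementary_abelian (G\<lparr>carrier := N\<rparr>) \<and> card N = q ^ 2))"
proof -
  define n where "n = (q + 2) div 2"
  have even_q: "even q"
    using assms(1,2) by simp
  have n_eq: "2 * n = 2 ^ d + 2"
    unfolding n_def assms(2)[symmetric] using even_q by simp
  interpret F: field F
    by fact
  have "group K"
    using assms(5) by (simp add: dihedral_presentation_def)
  then interpret construction F d K n y u e
    using assms n_eq
    by (intro construction.intro binary_field.intro binary_field_axioms.intro
        dihedral.intro dihedral_axioms.intro construction_axioms.intro)
      (auto simp: n_def)
  have "mcfarland_parameters q 1 = (q ^ 2 * (q + 2), q * (q + 1), q)"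
  proof -
    have "q > 1"
      using one_less_power[of "2::nat" d] assms(1,2) by simp
    have "q ^ 2 - 1 = (q + 1) * (q - 1)"
      by (simp add: power2_eq_square algebra_simps)
    then have "(q ^ 2 - 1) div (q - 1) = q + 1"
      using \<open>q > 1\<close> by (simp only: nonzero_mult_div_cancel_right)
    moreover have "mcfarland_parameters q 1
        = (q ^ 2 * ((q ^ 2 - 1) div (q - 1) + 1), q * ((q ^ 2 - 1) div (q - 1)), q * ((q - 1) div (q - 1)))"
      by (simp add: mcfarland_parameters_def numeral_2_eq_2)
    ultimately show ?thesis
      using \<open>q > 1\<close> by simp
  qed
  moreover have "\<exists>D. difference_set twisted (q ^ 2 * (q + 2)) (q * (q + 1)) q D"
    using ex_invariant_difference_set[OF F.binary_field_axioms K.dihedral_axioms n_eq assms(2)]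
      difference_set_twist by blast
  moreover have "\<not> comm_group twisted \<and> \<not> (\<exists>P. sylow_subgroup 2 P twisted \<and> P \<lhd> twisted) \<and>
      \<not> (\<exists>N. N \<lhd> twisted \<and> elementary_abelian (twisted\<lparr>carrier := N\<rparr>) \<and> card N = q ^ 2)"
    if d: "d \<ge> 2"
  proof -
    have "n = 2 ^ (d - 1) + 1"
      using n_eq d by (cases d) simp_all
    then interpret nonabelian_construction F d K n y u e
      using d by unfold_locales simp_all
    show ?thesis
      using twisted_not_commutative no_normal_sylow_2_subgroup no_normal_elementary_abelian_subgroup
      unfolding assms(2) by blast
  qed
  ultimately show ?thesis
    unfolding calG'_eq_twisted Let_def using twisted_group by blast
qed

end
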